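(* There is an algorithm which, given a string $T$ of length $n$, computes an LZRR parse of $T$ (as defined in the context) in $O(n^2\,\alpha_{n^2}(n^2))$ time using $O(n)$ words of working space, where $\alpha_k$ denotes the inverse of the $k$-th row of the Ackermann function.
   Context: Model of computation: unit-cost word RAM with word size $\Omega(\log_2 n)$ bits; space is measured in machine words. Let $T=T[1]T[2]\cdots T[n]$ be a string over an ordered alphabet $\Sigma$ (elements of $\Sigma$ are regarded as distinct from integers). $T[a..b]$ is the substring from position $a$ to $b$, $T[a..]=T[a..n]$, and $\mathsf{lcp}(a,b)$ is the length of the longest common prefix of $T[a..]$ and $T[b..]$. A bidirectional parse (BP) of $T$ is a sequence of phrases $f_1,\dots,f_b$ partitioning $T$, with $f_x=T[s_x..s_x+|f_x|-1]$, $s_1=1$, $s_{x+1}=s_x+|f_x|$, $s_{b+1}=n+1$. Each phrase is either a character phrase ($|f_x|=1$, storing the character $T[s_x]$) or a target phrase $\langle t_x,|f_x|\rangle$ with $t_x\in\{1,\dots,n\}$, $t_x\neq s_x$, $t_x+|f_x|-1\le n$ and $T[t_x..t_x+|f_x|-1]=T[s_x..s_x+|f_x|-1]$ (overlaps allowed). Define $g^0:\{1,\dots,n\}\to\{1,\dots,n\}\cup\Sigma$ by $g^0(x)=T[x]$ if $x$ lies in a character phrase and $g^0(x)=t_p+(x-s_p)$ if $x$ lies in the target phrase $f_p$; for $k\ge1$, $g^k(x)=g^{k-1}(x)$ if $g^{k-1}(x)\in\Sigma$ and $g^k(x)=g^0(g^{k-1}(x))$ otherwise. The BP is valid if $g^n(x)\in\Sigma$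 for all $x$. A partial bidirectional parse (PBP) $P=f_1,\dots,f_k$ is a sequence of phrases satisfying the same conditions but partitioning only a prefix $T[1..m]$ (reference positions may be anywhere in $\{1,\dots,n\}$ other than the phrase's own start); the position following $P$ is $i=m+1$. $B_P$ is the BP of $T$ obtained by appending to $P$ the character phrases $T[m+1],\dots,T[n]$; $P$ is valid if $B_P$ is valid. $P\cdot f$ denotes appending phrase $f$. For a valid PBP $P$ with following position $i\le n$ and $j\in\{1,\dots,n\}$, let $\mathsf{LF}(P,j)=\max(\{0\}\cup\{\ell\in\{1,\dots,\mathsf{lcp}(i,j)\}: P\cdot\langle j,\ell\rangle \text{ is a valid PBP}\})$. Let $M=\max_j \mathsf{LF}(P,j)$; $\mathsf{LP}(P)$ is the target phrase $\langle j^*,M\rangle$ for some $j^*$ with $\mathsf{LF}(P,j^* )=M$ if $M>0$, and the character phrase $T[i]$ otherwise. An LZRR parse of $T$ is a sequence $f_1,\dots,f_b$ obtained by $P_0=$ empty sequence, $f_{p+1}=\mathsf{LP}(P_p)$, $P_{p+1}=P_p\cdot f_{p+1}$, until $P_b$ covers all of $T$ (it is not unique because of ties). *)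

theory Defs
  imports Complex_Main "HOL-Library.Landau_Symbols" "HOL-Library.Sublist"
begin

section \<open>Strings and bidirectional parses\<close>

text \<open>Positions of a string are 1-based.\<close>

definition char_at :: "'a list \<Rightarrow> nat \<Rightarrow> 'a" where
  "char_at T x = T ! (x - 1)"

definition substr :: "'a list \<Rightarrow> nat \<Rightarrow> nat \<Rightarrow> 'a list" where
  "substr T a b = take (Suc b - a) (drop (a - 1) T)"

definition lcp :: "'a list \<Rightarrow> nat \<Rightarrow> nat \<Rightarrow> nat" where
  "lcp T a b = length (longest_common_prefix (substr T a (length T)) (substr T b (length T)))"

datatype 'a phrase = CharP 'a | TargetP nat nat

fun plen :: "'a phrase \<Rightarrow> nat" where
  "plen (CharP c) = 1"
| "plen (TargetP t l) = l"

text \<open>Length \<open>m\<close> of the prefix \<open>T[1..m]\<close> covered by a phrase sequence.\<close>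

definition covered :: "'a phrase list \<Rightarrow> nat" where
  "covered P = sum_list (map plen P)"

text \<open>Starting position of the phrase with (0-based) index \<open>p\<close>; for \<open>p = length P\<close> this is the
  position following \<open>P\<close>.\<close>

definition start :: "'a phrase list \<Rightarrow> nat \<Rightarrow> nat" where
  "start P p = Suc (covered (take p P))"

fun phrase_ok :: "'a list \<Rightarrow> nat \<Rightarrow> 'a phrase \<Rightarrow> bool" where
  "phrase_ok T s (CharP c) \<longleftrightarrow> s \<in> {1..length T} \<and> c = char_at T s"
| "phrase_ok T s (TargetP t l) \<longleftrightarrow>
     l \<ge> 1 \<and> s \<in> {1..length T} \<and> s + l - 1 \<le> length T \<and>
     t \<in> {1..length T} \<and> t \<noteq> s \<and> t + l - 1 \<le> length T \<and>
     substr T t (t + l - 1) = substr T s (s + l - 1)"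

definition is_PBP :: "'a list \<Rightarrow> 'a phrase list \<Rightarrow> bool" where
  "is_PBP T P \<longleftrightarrow> (\<forall>p<length P. phrase_ok T (start P p) (P ! p))"

definition is_BP :: "'a list \<Rightarrow> 'a phrase list \<Rightarrow> bool" where
  "is_BP T B \<longleftrightarrow> is_PBP T B \<and> covered B = length T"

definition phrase_index :: "'a phrase list \<Rightarrow> nat \<Rightarrow> nat" where
  "phrase_index B x = (THE p. p < length B \<and> start B p \<le> x \<and> x < start B (Suc p))"

text \<open>The codomain \<open>{1,\<dots>,n} \<union> \<Sigma>\<close> (disjoint union) is rendered by a sum type: \<open>Inl\<close> marks
  positions, \<open>Inr\<close> marks characters.\<close>

definition g0 :: "'a list \<Rightarrow> 'a phrase list \<Rightarrow> nat \<Rightarrow> nat + 'a" where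
  "g0 T B x = (let p = phrase_index B x in
     case B ! p of
       CharP c \<Rightarrow> Inr (char_at T x)
     | TargetP t l \<Rightarrow> Inl (t + (x - start B p)))"

primrec g :: "'a list \<Rightarrow> 'a phrase list \<Rightarrow> nat \<Rightarrow> nat \<Rightarrow> nat + 'a" where
  "g T B 0 x = g0 T B x"
| "g T B (Suc k) x = (case g T B k x of Inr c \<Rightarrow> Inr c | Inl y \<Rightarrow> g0 T B y)"

definition valid_BP :: "'a list \<Rightarrow> 'a phrase list \<Rightarrow> bool" where
  "valid_BP T B \<longleftrightarrow> is_BP T B \<and> (\<forall>x\<in>{1..length T}. \<exists>c. g T B (length T) x = Inr c)"

definition BP_of :: "'a list \<Rightarrow> 'a phrase list \<Rightarrow> 'a phrase list" where
  "BP_of T P = P @ map CharP (drop (covered P) T)"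

definition valid_PBP :: "'a list \<Rightarrow> 'a phrase list \<Rightarrow> bool" where
  "valid_PBP T P \<longleftrightarrow> is_PBP T P \<and> valid_BP T (BP_of T P)"


section \<open>LZRR\<close>

definition LF :: "'a list \<Rightarrow> 'a phrase list \<Rightarrow> nat \<Rightarrow> nat" where
  "LF T P j = Max ({0} \<union> {l \<in> {1..lcp T (Suc (covered P)) j}. valid_PBP T (P @ [TargetP j l])})"

definition maxLF :: "'a list \<Rightarrow> 'a phrase list \<Rightarrow> nat" where
  "maxLF T P = Max (LF T P ` {1..length T})"

text \<open>\<open>LP\<close> is a relation because ties between reference positions may be broken arbitrarily.\<close>

definition is_LP :: "'a list \<Rightarrow> 'a phrase list \<Rightarrow> 'a phrase \<Rightarrow> bool" where
  "is_LP T P f \<longleftrightarrow>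
     (if maxLF T P > 0
      then \<exists>j\<in>{1..length T}. LF T P j = maxLF T P \<and> f = TargetP j (maxLF T P)
      else f = CharP (char_at T (Suc (covered P))))"

inductive LZRR_prefix :: "'a list \<Rightarrow> 'a phrase list \<Rightarrow> bool" for T :: "'a list" where
  empty: "LZRR_prefix T []"
| extend: "LZRR_prefix T P \<Longrightarrow> covered P < length T \<Longrightarrow> is_LP T P f \<Longrightarrow> LZRR_prefix T (P @ [f])"

definition LZRR_parse :: "'a list \<Rightarrow> 'a phrase list \<Rightarrow> bool" where
  "LZRR_parse T B \<longleftrightarrow> LZRR_prefix T B \<and> covered B = length T"


section \<open>Row inverses of the Ackermann function\<close>

text \<open>The variant customary in the union-find literature: row 1 is \<open>2^j\<close>, row 2 is the tower
  function.\<close>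

fun ackermann :: "nat \<Rightarrow> nat \<Rightarrow> nat" where
  "ackermann 0 j = 2 * j"
| "ackermann (Suc k) 0 = 1"
| "ackermann (Suc k) (Suc j) = ackermann k (ackermann (Suc k) j)"

definition ack_row_inverse :: "nat \<Rightarrow> nat \<Rightarrow> nat" where
  "ack_row_inverse k x = (LEAST j. x \<le> ackermann k j)"


section \<open>Unit-cost word RAM\<close>

text \<open>A memory cell or register holds either a \<open>w\<close>-bit word (a natural number below \<open>2^w\<close>)
  or a symbol of the ordered alphabet. Symbols can be copied and compared with each other, but not
  used in arithmetic. Ill-typed operations and memory accesses out of range get stuck without
  halting.\<close>

datatype 'a cell = Word nat | Sym 'a

datatype binop = Add | Sub | Mul | Div | Mod | And | Or | Xor | Shl | Shr

text \<open>Numeric arguments are register numbers, except for the constant (second argument) of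
  \<open>Const\<close> and the jump targets (last argument of the jumps).\<close>

datatype instr =
    Const nat nat
  | Move nat nat
  | Op binop nat nat nat
  | Load nat nat
  | Store nat nat
  | Jump nat
  | JumpEq nat nat nat
  | JumpLess nat nat nat
  | Halt

fun word_op :: "nat \<Rightarrow> binop \<Rightarrow> nat \<Rightarrow> nat \<Rightarrow> nat" where
  "word_op w Add x y = (x + y) mod 2 ^ w"
| "word_op w Sub x y = (x + 2 ^ w - y) mod 2 ^ w"
| "word_op w Mul x y = (x * y) mod 2 ^ w"
| "word_op w Div x y = (x div y) mod 2 ^ w"
| "word_op w Mod x y = (x mod y) mod 2 ^ w"
| "word_op w And x y = Bit_Operations.and x y mod 2 ^ w"
| "word_op w Or x y = Bit_Operations.or x y mod 2 ^ w"
| "word_op w Xor x y = Bit_Operations.xor x y mod 2 ^ w"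
| "word_op w Shl x y = push_bit y x mod 2 ^ w"
| "word_op w Shr x y = drop_bit y x mod 2 ^ w"

fun cell_eq :: "'a cell \<Rightarrow> 'a cell \<Rightarrow> bool option" where
  "cell_eq (Word x) (Word y) = Some (x = y)"
| "cell_eq (Sym c) (Sym d) = Some (c = d)"
| "cell_eq _ _ = None"

fun cell_less :: "'a::linorder cell \<Rightarrow> 'a cell \<Rightarrow> bool option" where
  "cell_less (Word x) (Word y) = Some (x < y)"
| "cell_less (Sym c) (Sym d) = Some (c < d)"
| "cell_less _ _ = None"

record 'a config =
  pc :: nat
  regs :: "nat \<Rightarrow> 'a cell"
  mem :: "'a cell list"

definition set_reg :: "nat \<Rightarrow> 'a cell \<Rightarrow> 'a config \<Rightarrow> 'a config" where
  "set_reg r v c = c\<lparr>pc := Suc (pc c), regs := (regs c)(r := v)\<rparr>"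

fun exec_instr :: "nat \<Rightarrow> instr \<Rightarrow> 'a::linorder config \<Rightarrow> 'a config option" where
  "exec_instr w (Const r k) c = Some (set_reg r (Word (k mod 2 ^ w)) c)"
| "exec_instr w (Move r s) c = Some (set_reg r (regs c s) c)"
| "exec_instr w (Op b r s t) c =
     (case (regs c s, regs c t) of
        (Word x, Word y) \<Rightarrow> Some (set_reg r (Word (word_op w b x y)) c)
      | _ \<Rightarrow> None)"
| "exec_instr w (Load r s) c =
     (case regs c s of
        Word a \<Rightarrow> if a < length (mem c) then Some (set_reg r (mem c ! a) c) else None
      | Sym _ \<Rightarrow> None)"
| "exec_instr w (Store r s) c =
     (case regs c r of
        Word a \<Rightarrow> if a < length (mem c)
                   then Some (c\<lparr>pc := Suc (pc c), mem := (mem c)[a := regs c s]\<rparr>) else None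
      | Sym _ \<Rightarrow> None)"
| "exec_instr w (Jump l) c = Some (c\<lparr>pc := l\<rparr>)"
| "exec_instr w (JumpEq r s l) c =
     map_option (\<lambda>b. c\<lparr>pc := (if b then l else Suc (pc c))\<rparr>) (cell_eq (regs c r) (regs c s))"
| "exec_instr w (JumpLess r s l) c =
     map_option (\<lambda>b. c\<lparr>pc := (if b then l else Suc (pc c))\<rparr>) (cell_less (regs c r) (regs c s))"
| "exec_instr w Halt c = None"

definition step :: "nat \<Rightarrow> instr list \<Rightarrow> 'a::linorder config \<Rightarrow> 'a config \<Rightarrow> bool" where
  "step w prog c c' \<longleftrightarrow> pc c < length prog \<and> exec_instr w (prog ! pc c) c = Some c'"

definition halted :: "instr list \<Rightarrow> 'a config \<Rightarrow> bool" where
  "halted prog c \<longleftrightarrow> pc c < length prog \<and> prog ! pc c = Halt"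

text \<open>The memory consists of the input string at addresses \<open>0, \<dots>, n - 1\<close> followed by \<open>e\<close>
  further words, which must also accommodate the output unless it overwrites the input. Register
  0 holds \<open>n\<close>.\<close>

definition init_config :: "'a list \<Rightarrow> nat \<Rightarrow> 'a config" where
  "init_config T e = \<lparr>pc = 0, regs = (\<lambda>_. Word 0)(0 := Word (length T)),
     mem = map Sym T @ replicate e (Word 0)\<rparr>"

text \<open>A phrase is output as two consecutive cells; a leading 0 marks a character phrase, which is
  unambiguous because target phrases are nonempty.\<close>

fun encode_phrase :: "'a phrase \<Rightarrow> 'a cell list" where
  "encode_phrase (CharP c) = [Word 0, Sym c]"
| "encode_phrase (TargetP t l) = [Word l, Word t]"

text \<open>The output is an array of phrases: register 0 holds its address, register 1 the number of
  phrases.\<close>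

definition outputs :: "'a config \<Rightarrow> 'a phrase list \<Rightarrow> bool" where
  "outputs c B \<longleftrightarrow> (\<exists>a. regs c 0 = Word a \<and> regs c 1 = Word (length B) \<and>
     take (2 * length B) (drop a (mem c)) = concat (map encode_phrase B))"

text \<open>\<open>prog\<close>, run on \<open>T\<close> with word size \<open>w\<close> and \<open>e\<close> words of working space, halts after at most
  \<open>t\<close> unit-cost steps and outputs an LZRR parse of \<open>T\<close>.\<close>

definition computes_LZRR ::
    "instr list \<Rightarrow> nat \<Rightarrow> nat \<Rightarrow> nat \<Rightarrow> 'a::linorder list \<Rightarrow> bool" where
  "computes_LZRR prog w t e T \<longleftrightarrow>
     (\<exists>k\<le>t. \<exists>c B. (step w prog ^^ k) (init_config T e) c \<and> halted prog c \<and>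
        outputs c B \<and> LZRR_parse T B)"

end

theory Submission
  imports Defs
begin

text \<open>
  A partial parse is valid iff the functional graph of its references is acyclic, that is, a forest
  whose roots are the positions without reference. If the root of every position is known, then
  appending \<open>\<langle>j, l\<rangle>\<close> at position \<open>i\<close> keeps the graph acyclic iff the map
  \<open>x \<mapsto> root (x + j - i)\<close> has no cycle inside \<open>{i, \<dots>, i + l - 1}\<close>, which walks leaving stamps
  decide in time \<open>O(l)\<close>; no union-find structure is needed.

  Validity is inherited by shorter references, so the longest one is found by trying for
  \<open>j = 1, \<dots>, n\<close> to improve the best length \<open>M\<close> found so far to \<open>M + 1\<close>: every one of the at most
  \<open>2n\<close> trials either discards \<open>j\<close> or increments \<open>M\<close>. A phrase of length \<open>l\<close> thus costs
  \<open>O(n l)\<close>, and recomputing the roots by \<open>n\<close> walks of at most \<open>l\<close> steps each is no more expensive.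
  Summing over the phrases gives \<open>O(n\<^sup>2)\<close>, which is within the claimed bound because
  the inverse Ackermann factor is positive for \<open>n \<ge> 2\<close>.
\<close>

section \<open>Structured programs with a step budget\<close>

text \<open>A cycle created by a new phrase must run through its interval, since the old graph is
  acyclic, and between two visits to the interval it follows old edges only. Every position of the
  interval is still a root of the old graph, and old edges out of any position end at its root; so
  replacing each old path by one jump to its end loses no cycle. This works even if the source
  overlaps the new phrase or lies to its right.

  The linear cost of a trial is an amortisation: each step that continues a walk stamps a fresh
  position of the interval, and stamps are reset only there. After acceptance a walk to a new root
  cannot repeat a position of the interval, which bounds it by the phrase length.

  The cost claim concerns a concrete instruction set with word arithmetic, so the bounds are proved
  for an actual program. The numerical constants are generous estimates of instruction
  counts.\<close>

datatype cond = EqC nat nat | LessC nat nat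

datatype com = Skip | Basic instr | Seq com com (infixr ";;" 60) | Cond cond com com | Loop cond com

fun jump_if :: "cond \<Rightarrow> nat \<Rightarrow> instr" where
  "jump_if (EqC r s) l = JumpEq r s l"
| "jump_if (LessC r s) l = JumpLess r s l"

fun holds :: "cond \<Rightarrow> (nat \<Rightarrow> 'a::linorder cell) \<Rightarrow> bool option" where
  "holds (EqC r s) R = cell_eq (R r) (R s)"
| "holds (LessC r s) R = cell_less (R r) (R s)"

text \<open>Jump targets are absolute, so the address \<open>p\<close> of the fragment is passed
  down. The machine can only jump when a comparison succeeds; hence the else branch comes first, and
  a loop is left by a jump that is skipped while the condition holds. Each loop test thus goes with
  two jumps: test and exit, or test and return.\<close>

fun compile :: "nat \<Rightarrow> com \<Rightarrow> instr list" where
  "compile p Skip = []"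
| "compile p (Basic i) = [i]"
| "compile p (c ;; d) = compile p c @ compile (p + length (compile p c)) d"
| "compile p (Cond b c d) =
     (let D = compile (p + 1) d; q = p + 2 + length D; C = compile q c
      in jump_if b q # D @ Jump (q + length C) # C)"
| "compile p (Loop b c) =
     (let C = compile (p + 2) c
      in jump_if b (p + 2) # Jump (p + 3 + length C) # C @ [Jump p])"

text \<open>Jumps and \<open>Halt\<close> get the condition \<open>False\<close>: control flow comes
  only from the structured constructs. The existential conditions exclude stuck states.\<close>

fun basic_vc :: "nat \<Rightarrow> instr \<Rightarrow> ((nat \<Rightarrow> 'a::linorder cell) \<Rightarrow> 'a cell list \<Rightarrow> bool) \<Rightarrow>
    (nat \<Rightarrow> 'a cell) \<Rightarrow> 'a cell list \<Rightarrow> bool" where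
  "basic_vc w (Const r v) Q R m \<longleftrightarrow> Q (R(r := Word (v mod 2 ^ w))) m"
| "basic_vc w (Move r s) Q R m \<longleftrightarrow> Q (R(r := R s)) m"
| "basic_vc w (Op b r s t) Q R m \<longleftrightarrow>
     (\<exists>x y. R s = Word x \<and> R t = Word y \<and> Q (R(r := Word (word_op w b x y))) m)"
| "basic_vc w (Load r s) Q R m \<longleftrightarrow> (\<exists>a. R s = Word a \<and> a < length m \<and> Q (R(r := m ! a)) m)"
| "basic_vc w (Store r s) Q R m \<longleftrightarrow> (\<exists>a. R r = Word a \<and> a < length m \<and> Q R (m[a := R s]))"
| "basic_vc w _ Q R m \<longleftrightarrow> False"

text \<open>The last argument of an assertion is the number of steps that may still be made, so that
  it doubles as the termination measure of loops. Both branches of a conditional are charged for two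
  jumps.\<close>

primrec vc :: "nat \<Rightarrow> com \<Rightarrow> ((nat \<Rightarrow> 'a::linorder cell) \<Rightarrow> 'a cell list \<Rightarrow> nat \<Rightarrow> bool) \<Rightarrow>
    (nat \<Rightarrow> 'a cell) \<Rightarrow> 'a cell list \<Rightarrow> nat \<Rightarrow> bool" where
  "vc w Skip Q = Q"
| "vc w (Basic i) Q = (\<lambda>R m k. 1 \<le> k \<and> basic_vc w i (\<lambda>R m. Q R m (k - 1)) R m)"
| "vc w (c ;; d) Q = vc w c (vc w d Q)"
| "vc w (Cond b c d) Q = (\<lambda>R m k. 2 \<le> k \<and>
     (case holds b R of None \<Rightarrow> False
      | Some v \<Rightarrow> if v then vc w c Q R m (k - 2) else vc w d Q R m (k - 2)))"
| "vc w (Loop b c) Q = (\<lambda>R m k. \<exists>I. I R m k \<and>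
     (\<forall>R m k. I R m k \<longrightarrow> 2 \<le> k \<and>
       (case holds b R of None \<Rightarrow> False
        | Some v \<Rightarrow> if v then vc w c I R m (k - 2) else Q R m (k - 2))))"

declare vc.simps(5) [simp del]

lemma basic_vc_mono:
  assumes "basic_vc w i Q R m" "\<And>R m. Q R m \<Longrightarrow> Q' R m"
  shows "basic_vc w i Q' R m"
  using assms by (cases i) auto

lemma vc_mono:
  assumes "vc w c Q R m k" "\<And>R m k. Q R m k \<Longrightarrow> Q' R m k"
  shows "vc w c Q' R m k"
  using assms
proof (induction c arbitrary: Q Q' R m k)
  case (Basic i)
  then show ?case by (auto elim: basic_vc_mono)
next
  case (Seq c d)
  have "vc w c (vc w d Q) R m k" using Seq.prems(1) by simp
  then have "vc w c (vc w d Q') R m k"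
    by (rule Seq.IH(1)) (erule Seq.IH(2), erule Seq.prems(2))
  then show ?case by simp
next
  case (Cond b c d)
  show ?case
    using Cond.prems(1) Cond.IH(1)[OF _ Cond.prems(2)] Cond.IH(2)[OF _ Cond.prems(2)]
    by (auto split: if_splits option.splits)
next
  case (Loop b c)
  obtain I where "I R m k" and I: "\<And>R m k. I R m k \<Longrightarrow> 2 \<le> k \<and>
      (case holds b R of None \<Rightarrow> False
        | Some v \<Rightarrow> if v then vc w c I R m (k - 2) else Q R m (k - 2))"
    using Loop.prems(1) unfolding vc.simps by blast
  then show ?case unfolding vc.simps
  proof (intro exI[of _ I] conjI allI impI)
    fix R m k
    assume "I R m k"
    from I[OF this] show "case holds b R of None \<Rightarrow> False
        | Some v \<Rightarrow> if v then vc w c I R m (k - 2) else Q' R m (k - 2)"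
      using Loop.prems(2) by (auto split: option.splits)
  qed auto
qed simp

lemma vc_seqI:
  assumes "vc w c Q' R m k" "\<And>R m k. Q' R m k \<Longrightarrow> vc w d Q R m k"
  shows "vc w (c ;; d) Q R m k"
  using vc_mono[OF assms] by simp

lemma vc_loopI:
  assumes "I R m k"
    and "\<And>R m k. I R m k \<Longrightarrow> 2 \<le> k \<and> holds b R \<noteq> None"
    and "\<And>R m k. I R m k \<Longrightarrow> holds b R = Some True \<Longrightarrow> vc w c I R m (k - 2)"
    and "\<And>R m k. I R m k \<Longrightarrow> holds b R = Some False \<Longrightarrow> Q R m (k - 2)"
  shows "vc w (Loop b c) Q R m k"
  unfolding vc.simps
proof (intro exI[of _ I] conjI allI impI)
  fix R m k
  assume I: "I R m k"
  then show "2 \<le> k" using assms(2) by blast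
  obtain v where "holds b R = Some v" using I assms(2) by blast
  then show "case holds b R of None \<Rightarrow> False
      | Some v \<Rightarrow> if v then vc w c I R m (k - 2) else Q R m (k - 2)"
    using assms(3,4)[OF I] by (cases v) auto
qed (rule assms(1))

section \<open>Soundness of the budgeted verification conditions for compiled code\<close>

definition code_at :: "instr list \<Rightarrow> nat \<Rightarrow> instr list \<Rightarrow> bool" where
  "code_at prog p xs \<longleftrightarrow> (\<exists>us vs. prog = us @ xs @ vs \<and> length us = p)"

lemma code_at_append:
  "code_at prog p (xs @ ys) \<longleftrightarrow> code_at prog p xs \<and> code_at prog (p + length xs) ys"
proof
  assume "code_at prog p (xs @ ys)"
  then obtain us vs where 1: "prog = us @ xs @ ys @ vs" "length us = p"
    by (auto simp: code_at_def)
  show "code_at prog p xs \<and> code_at prog (p + length xs) ys"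
    unfolding code_at_def
    using 1 by (metis append.assoc length_append)
next
  assume "code_at prog p xs \<and> code_at prog (p + length xs) ys"
  then obtain us vs us' vs' where 1: "prog = us @ xs @ vs" "length us = p"
    "prog = us' @ ys @ vs'" "length us' = p + length xs"
    unfolding code_at_def by blast
  then have "(us @ xs) @ vs = us' @ ys @ vs'" "length (us @ xs) = length us'" by auto
  then have "us @ xs = us'" "vs = ys @ vs'" by (metis append_eq_append_conv)+
  then have "prog = us @ (xs @ ys) @ vs'" using 1(1) by simp
  then show "code_at prog p (xs @ ys)" unfolding code_at_def using 1(2) by blast
qed

lemma code_at_singleton: "code_at prog p [x] \<longleftrightarrow> p < length prog \<and> prog ! p = x"
proof
  assume "p < length prog \<and> prog ! p = x"
  then have "prog = take p prog @ [x] @ drop (Suc p) prog" "length (take p prog) = p"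
    by (auto simp: id_take_nth_drop)
  then show "code_at prog p [x]" unfolding code_at_def by blast
qed (auto simp: code_at_def nth_append)

lemma code_at_Cons:
  "code_at prog p (x # xs) \<longleftrightarrow> p < length prog \<and> prog ! p = x \<and> code_at prog (Suc p) xs"
  using code_at_append[of prog p "[x]" xs] by (simp add: code_at_singleton)

text \<open>The budget is only an upper bound: \<open>t + k' \<le> k\<close> allows part of it to be
  thrown away, which absorbs conditionals charged for more jumps than they make.\<close>

definition reaches :: "nat \<Rightarrow> instr list \<Rightarrow> nat \<Rightarrow> nat \<Rightarrow>
    ((nat \<Rightarrow> 'a::linorder cell) \<Rightarrow> 'a cell list \<Rightarrow> nat \<Rightarrow> bool) \<Rightarrow>
    (nat \<Rightarrow> 'a cell) \<Rightarrow> 'a cell list \<Rightarrow> nat \<Rightarrow> bool" where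
  "reaches w prog p q Q R m k \<longleftrightarrow> (\<exists>t R' m' k'. t + k' \<le> k \<and> Q R' m' k' \<and>
     (step w prog ^^ t) \<lparr>pc = p, regs = R, mem = m\<rparr> \<lparr>pc = q, regs = R', mem = m'\<rparr>)"

lemma reaches_refl: "Q R m k \<Longrightarrow> reaches w prog p p Q R m k"
  unfolding reaches_def by (intro exI[of _ 0] exI[of _ R] exI[of _ m] exI[of _ k]) auto

lemma reaches_trans:
  assumes "reaches w prog p q Q R m k"
    "\<And>R' m' k'. Q R' m' k' \<Longrightarrow> k' \<le> k \<Longrightarrow> reaches w prog q r Q' R' m' k'"
  shows "reaches w prog p r Q' R m k"
proof -
  obtain t R1 m1 k1 where 1: "t + k1 \<le> k" "Q R1 m1 k1"
    "(step w prog ^^ t) \<lparr>pc = p, regs = R, mem = m\<rparr> \<lparr>pc = q, regs = R1, mem = m1\<rparr>"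
    using assms(1) unfolding reaches_def by blast
  obtain u R2 m2 k2 where 2: "u + k2 \<le> k1" "Q' R2 m2 k2"
    "(step w prog ^^ u) \<lparr>pc = q, regs = R1, mem = m1\<rparr> \<lparr>pc = r, regs = R2, mem = m2\<rparr>"
    using assms(2)[OF 1(2)] 1(1) unfolding reaches_def by fastforce
  have "(step w prog ^^ (t + u)) \<lparr>pc = p, regs = R, mem = m\<rparr> \<lparr>pc = r, regs = R2, mem = m2\<rparr>"
    using 1(3) 2(3) by (auto simp: relpowp_add)
  then show ?thesis unfolding reaches_def using 1(1) 2(1,2)
    by (intro exI[of _ "t + u"] exI[of _ R2] exI[of _ m2] exI[of _ k2]) auto
qed

lemma reaches_step:
  assumes "p < length prog" "1 \<le> k"
    "exec_instr w (prog ! p) \<lparr>pc = p, regs = R, mem = m\<rparr> = Some \<lparr>pc = q, regs = R', mem = m'\<rparr>"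
    "Q R' m' (k - 1)"
  shows "reaches w prog p q Q R m k"
  unfolding reaches_def
  using assms by (intro exI[of _ 1] exI[of _ R'] exI[of _ m'] exI[of _ "k - 1"])
    (auto simp: step_def)

lemma reaches_basic:
  assumes "code_at prog p [i]" "1 \<le> k" "basic_vc w i (\<lambda>R m. Q R m (k - 1)) R m"
  shows "reaches w prog p (Suc p) Q R m k"
proof -
  have "\<exists>R' m'. exec_instr w i \<lparr>pc = p, regs = R, mem = m\<rparr> =
      Some \<lparr>pc = Suc p, regs = R', mem = m'\<rparr> \<and> Q R' m' (k - 1)"
    using assms(3) by (cases i) (auto simp: set_reg_def)
  then show ?thesis using assms(1,2) by (auto simp: code_at_singleton intro: reaches_step)
qed

lemma reaches_jump:
  assumes "p < length prog" "prog ! p = Jump q" "1 \<le> k" "Q R m (k - 1)"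
  shows "reaches w prog p q Q R m k"
  using assms by (auto intro: reaches_step)

lemma reaches_jump_if:
  assumes "p < length prog" "prog ! p = jump_if b q" "1 \<le> k" "holds b R = Some v" "Q R m (k - 1)"
  shows "reaches w prog p (if v then q else Suc p) Q R m k"
  using assms by (cases b) (auto intro: reaches_step)

text \<open>Structural induction on the program; for a loop, an inner induction on the budget, which
  drops in every iteration because the test and the return jump are paid for.\<close>

lemma vc_sound:
  assumes "code_at prog p (compile p c)" "vc w c Q R m k"
  shows "reaches w prog p (p + length (compile p c)) Q R m k"
  using assms
proof (induction c arbitrary: p Q R m k)
  case Skip
  then show ?case by (simp add: reaches_refl)
next
  case (Basic i)
  then show ?case by (simp add: reaches_basic)
next
  case (Seq c d)
  let ?q = "p + length (compile p c)"
  have "reaches w prog p ?q (vc w d Q) R m k"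
    using Seq.prems by (intro Seq.IH(1)) (auto simp: code_at_append)
  then have "reaches w prog p (?q + length (compile ?q d)) Q R m k"
    by (rule reaches_trans) (use Seq.prems in \<open>auto simp: code_at_append intro!: Seq.IH(2)\<close>)
  then show ?case by (simp add: add.assoc)
next
  case (Cond b c d)
  define D where "D = compile (p + 1) d"
  define q where "q = p + 2 + length D"
  define C where "C = compile q c"
  have len: "p + length (compile p (Cond b c d)) = q + length C"
    by (simp add: D_def q_def C_def Let_def)
  have code: "p < length prog" "prog ! p = jump_if b q" "code_at prog (p + 1) D"
    "p + 1 + length D < length prog" "prog ! (p + 1 + length D) = Jump (q + length C)"
    "code_at prog q C"
    using Cond.prems(1) by (auto simp: D_def q_def C_def Let_def code_at_Cons code_at_append)
  obtain v where v: "2 \<le> k" "holds b R = Some v"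
    "if v then vc w c Q R m (k - 2) else vc w d Q R m (k - 2)"
    using Cond.prems(2) by (auto split: option.splits)
  show ?case
  proof (cases v)
    case True
    \<comment> \<open>Entering the then branch takes one jump; the second step charged is
      discarded.\<close>
    have "reaches w prog p q (\<lambda>R' m' k'. R' = R \<and> m' = m \<and> k' = k - 2) R m (k - 1)"
      using reaches_jump_if[OF code(1,2), of "k - 1" R v] v True by auto
    then have "reaches w prog p q (\<lambda>R' m' k'. R' = R \<and> m' = m \<and> k' = k - 2) R m k"
      unfolding reaches_def by (meson diff_le_self le_trans)
    then show ?thesis unfolding len
      by (rule reaches_trans) (use v True code in \<open>auto simp: C_def intro!: Cond.IH(1)\<close>)
  next
    case False
    have "reaches w prog p (p + 1) (\<lambda>R' m' k'. R' = R \<and> m' = m \<and> k' = k - 1) R m k"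
      using reaches_jump_if[OF code(1,2), of k R v] v False by auto
    then show ?thesis unfolding len
    proof (rule reaches_trans)
      fix R' m' k'
      assume "R' = R \<and> m' = m \<and> k' = k - 1"
      then have eq: "R' = R" "m' = m" "k' = Suc (k - 2)" using v by auto
      have "reaches w prog (p + 1) (p + 1 + length D) Q R m (k - 2)"
        unfolding D_def by (rule Cond.IH(2)) (use v False code in \<open>auto simp: D_def\<close>)
      \<comment> \<open>The branch itself runs on \<open>k - 2\<close>; one step is kept in reserve
        for the jump over the then branch.\<close>
      then have "reaches w prog (p + 1) (p + 1 + length D) (\<lambda>R m k. 1 \<le> k \<and> Q R m (k - 1)) R m k'"
        unfolding reaches_def eq by (metis Suc_le_mono add_Suc_right diff_Suc_1 le_add1 plus_1_eq_Suc)
      then show "reaches w prog (p + 1) (q + length C) Q R' m' k'"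
        unfolding eq(1,2) by (rule reaches_trans) (use code in \<open>auto intro: reaches_jump\<close>)
    qed
  qed
next
  case (Loop b c)
  define C where "C = compile (p + 2) c"
  let ?e = "p + 3 + length C"
  have len: "p + length (compile p (Loop b c)) = ?e" by (simp add: C_def Let_def)
  have code: "p < length prog" "prog ! p = jump_if b (p + 2)" "p + 1 < length prog"
    "prog ! (p + 1) = Jump ?e" "code_at prog (p + 2) C"
    "p + 2 + length C < length prog" "prog ! (p + 2 + length C) = Jump p"
    using Loop.prems(1) by (auto simp: C_def Let_def code_at_Cons code_at_append)
  obtain I where I0: "I R m k" and I: "\<And>R m k. I R m k \<Longrightarrow> 2 \<le> k \<and>
       (case holds b R of None \<Rightarrow> False
        | Some v \<Rightarrow> if v then vc w c I R m (k - 2) else Q R m (k - 2))"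
    using Loop.prems(2) unfolding vc.simps by blast
  have "reaches w prog p ?e Q R m k" using I0
  proof (induction k arbitrary: R m rule: less_induct)
    case (less k)
    obtain v where v: "2 \<le> k" "holds b R = Some v"
      "if v then vc w c I R m (k - 2) else Q R m (k - 2)"
      using I[OF less.prems] by (auto split: option.splits)
    let ?q = "if v then p + 2 else Suc p"
    have 1: "reaches w prog p ?q (\<lambda>R' m' k'. R' = R \<and> m' = m \<and> k' = k - 1) R m k"
      using reaches_jump_if[OF code(1,2), of k R v] v by auto
    show ?case
    proof (rule reaches_trans[OF 1])
      fix R' m' k'
      assume "R' = R \<and> m' = m \<and> k' = k - 1"
      then have eq: "R' = R" "m' = m" "k' = Suc (k - 2)" using v by auto
      show "reaches w prog ?q ?e Q R' m' k'"
      proof (cases v)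
        case False
        then show ?thesis using v code(3,4) eq by (auto intro: reaches_jump)
      next
        case True
        have "reaches w prog (p + 2) (p + 2 + length C) I R m (k - 2)"
          unfolding C_def by (rule Loop.IH) (use v True code in \<open>auto simp: C_def\<close>)
        then have "reaches w prog (p + 2) (p + 2 + length C) (\<lambda>R m k. 1 \<le> k \<and> I R m (k - 1)) R m k'"
          unfolding reaches_def eq by (metis Suc_le_mono add_Suc_right diff_Suc_1 le_add1 plus_1_eq_Suc)
        then have "reaches w prog (p + 2) p (\<lambda>R m k'. k' < k \<and> I R m k') R m k'"
          by (rule reaches_trans) (use code v eq(3) in \<open>auto intro!: reaches_jump\<close>)
        then have "reaches w prog (p + 2) ?e Q R m k'"
          by (rule reaches_trans) (use less.IH in auto)
        then show ?thesis using True eq by simp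
      qed
    qed
  qed
  then show ?case unfolding len .
qed

lemma computes_LZRRI:
  fixes T :: "'a::linorder list"
  assumes "vc w c (\<lambda>R m k. \<exists>B. outputs \<lparr>pc = 0, regs = R, mem = m\<rparr> B \<and> LZRR_parse T B)
    ((\<lambda>_. Word 0)(0 := Word (length T))) (map Sym T @ replicate e (Word 0)) t"
  shows "computes_LZRR (compile 0 c @ [Halt]) w t e T"
proof -
  let ?prog = "compile 0 c @ [Halt]" and ?l = "length (compile 0 c)"
  have "code_at ?prog 0 (compile 0 c)" by (auto simp: code_at_def)
  from vc_sound[OF this assms] obtain k R m k' B where
    "k + k' \<le> t" "outputs \<lparr>pc = 0, regs = R, mem = m\<rparr> B" "LZRR_parse T B"
    "(step w ?prog ^^ k) (init_config T e) \<lparr>pc = ?l, regs = R, mem = m\<rparr>"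
    by (auto simp: reaches_def init_config_def)
  moreover have "halted ?prog \<lparr>pc = ?l, regs = R, mem = m\<rparr>" by (simp add: halted_def)
  ultimately show ?thesis
    unfolding computes_LZRR_def
    by (intro exI[of _ k] conjI exI[of _ "\<lparr>pc = ?l, regs = R, mem = m\<rparr>"] exI[of _ B])
      (simp_all add: outputs_def)
qed

section \<open>Validity as acyclicity\<close>

text \<open>The graph of \<open>g0\<close> on 0-based positions. Character phrases contribute
  nothing, so \<open>P\<close> and its completion \<open>BP_of T P\<close> have the same
  graph.\<close>

definition edges :: "'a phrase list \<Rightarrow> (nat \<times> nat) set" where
  "edges P = {(covered (take p P) + d, t - 1 + d) | p t l d.
     p < length P \<and> P ! p = TargetP t l \<and> d < l}"

lemma covered_simps [simp]:
  "covered [] = 0" "covered (f # P) = plen f + covered P" "covered (P @ Q) = covered P + covered Q"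
  by (simp_all add: covered_def)

lemma edges_Nil [simp]: "edges [] = {}"
  by (simp add: edges_def)

lemma edges_snoc:
  "edges (P @ [f]) = edges P \<union> {(covered P + d, t - 1 + d) | t l d. f = TargetP t l \<and> d < l}"
    (is "?L = ?R")
proof
  show "?L \<subseteq> ?R"
    unfolding edges_def by (auto simp: nth_append less_Suc_eq)
  show "?R \<subseteq> ?L"
  proof
    fix e assume "e \<in> ?R"
    then consider (old) p t l d where "e = (covered (take p P) + d, t - 1 + d)" "p < length P"
        "P ! p = TargetP t l" "d < l"
      | (new) t l d where "e = (covered P + d, t - 1 + d)" "f = TargetP t l" "d < l"
      unfolding edges_def by blast
    then show "e \<in> ?L"
    proof cases
      case old
      then show ?thesis unfolding edges_def
        by (intro CollectI exI[of _ p] exI[of _ t] exI[of _ l] exI[of _ d]) (auto simp: nth_append)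
    next
      case new
      then show ?thesis unfolding edges_def
        by (intro CollectI exI[of _ "length P"] exI[of _ t] exI[of _ l] exI[of _ d]) auto
    qed
  qed
qed

lemma edges_snoc_Char [simp]: "edges (P @ [CharP c]) = edges P"
  by (simp add: edges_snoc)

lemma edges_snoc_Target [simp]:
  "edges (P @ [TargetP t l]) = edges P \<union> {(covered P + d, t - 1 + d) | d. d < l}"
  by (auto simp: edges_snoc)

lemma is_PBP_Nil [simp]: "is_PBP T []"
  by (simp add: is_PBP_def)

lemma is_PBP_snoc [simp]:
  "is_PBP T (P @ [f]) \<longleftrightarrow> is_PBP T P \<and> phrase_ok T (Suc (covered P)) f"
  unfolding is_PBP_def start_def by (auto simp: nth_append less_Suc_eq)

lemma PBP_covered: "is_PBP T P \<Longrightarrow> covered P \<le> length T"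
proof (induction P rule: rev_induct)
  case (snoc f P)
  then show ?case by (cases f) auto
qed simp

lemma PBP_edges: "is_PBP T P \<Longrightarrow> edges P \<subseteq> {..<covered P} \<times> {..<length T}"
proof (induction P rule: rev_induct)
  case (snoc f P)
  then have IH: "edges P \<subseteq> {..<covered P} \<times> {..<length T}" by simp
  show ?case
  proof (cases f)
    case (CharP c)
    then show ?thesis using IH by auto
  next
    case (TargetP t l)
    then have "t \<ge> 1" "t + l - 1 \<le> length T" using snoc.prems by auto
    then have "{(covered P + d, t - 1 + d) | d. d < l} \<subseteq> {..<covered P + l} \<times> {..<length T}"
      by auto
    then show ?thesis using IH TargetP by auto
  qed
qed simp

lemma PBP_single_valued: "is_PBP T P \<Longrightarrow> single_valued (edges P)"
proof (induction P rule: rev_induct)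
  case (snoc f P)
  have "edges P \<subseteq> {..<covered P} \<times> {..<length T}" using snoc.prems PBP_edges by auto
  moreover have "single_valued (edges P)" using snoc by simp
  ultimately show ?case
    by (intro single_valuedI) (auto simp: edges_snoc dest: single_valuedD)
qed simp

lemma PBP_append_Chars:
  assumes "is_PBP T P" "covered P + k \<le> length T"
  defines "B \<equiv> P @ map CharP (take k (drop (covered P) T))"
  shows "is_PBP T B \<and> covered B = covered P + k \<and> edges B = edges P"
  using assms(2) unfolding B_def
proof (induction k)
  case (Suc k)
  let ?B = "P @ map CharP (take k (drop (covered P) T))"
  have "map CharP (take (Suc k) (drop (covered P) T)) =
      map CharP (take k (drop (covered P) T)) @ [CharP (T ! (covered P + k))]"
    using Suc.prems by (simp add: take_Suc_conv_app_nth)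
  then have eq: "P @ map CharP (take (Suc k) (drop (covered P) T)) = ?B @ [CharP (T ! (covered P + k))]"
    by simp
  have IH: "is_PBP T ?B" "covered ?B = covered P + k" "edges ?B = edges P" using Suc by auto
  show ?case unfolding eq is_PBP_snoc edges_snoc_Char
    using IH Suc.prems by (simp add: char_at_def del: covered_simps(3)) (simp add: covered_simps)
qed (simp add: assms(1))

lemma BP_of_edges:
  assumes "is_PBP T P"
  shows "is_BP T (BP_of T P)" "edges (BP_of T P) = edges P"
proof -
  have "covered P + (length T - covered P) \<le> length T"
    using PBP_covered[OF assms] by simp
  from PBP_append_Chars[OF assms this] show "is_BP T (BP_of T P)" "edges (BP_of T P) = edges P"
    using PBP_covered[OF assms] by (auto simp: BP_of_def is_BP_def)
qed

section \<open>Iterated references as paths in the graph\<close>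

lemma covered_take_mono: "p \<le> q \<Longrightarrow> covered (take p B) \<le> covered (take q B)"
  by (metis covered_simps(3) le_add1 le_Suc_ex take_add)

lemma covered_take_Suc:
  "p < length B \<Longrightarrow> covered (take (Suc p) B) = covered (take p B) + plen (B ! p)"
  by (simp add: take_Suc_conv_app_nth)

lemma phrase_index_eq:
  assumes "p < length B" "d < plen (B ! p)"
  shows "phrase_index B (Suc (covered (take p B) + d)) = p"
  unfolding phrase_index_def
proof (rule the_equality)
  show "p < length B \<and> start B p \<le> Suc (covered (take p B) + d) \<and>
      Suc (covered (take p B) + d) < start B (Suc p)"
    using assms by (auto simp: start_def covered_take_Suc)
next
  fix q
  assume q: "q < length B \<and> start B q \<le> Suc (covered (take p B) + d) \<and>
      Suc (covered (take p B) + d) < start B (Suc q)"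
  have "\<not> q < p"
    using q covered_take_mono[of "Suc q" p B] by (auto simp: start_def)
  moreover have "\<not> p < q"
    using q assms covered_take_mono[of "Suc p" q B] covered_take_Suc[of p B] by (auto simp: start_def)
  ultimately show "q = p" by simp
qed

lemma phrase_containing:
  assumes "x < covered B"
  obtains p d where "p < length B" "d < plen (B ! p)" "x = covered (take p B) + d"
proof -
  have "\<exists>p<length B. \<exists>d<plen (B ! p). x = covered (take p B) + d" using assms
  proof (induction B rule: rev_induct)
    case (snoc f B)
    show ?case
    proof (cases "x < covered B")
      case True
      then obtain p d where "p < length B" "d < plen (B ! p)" "x = covered (take p B) + d"
        using snoc.IH by blast
      then show ?thesis by (intro exI[of _ p] conjI exI[of _ d]) (auto simp: nth_append)
    next
      case False
      then show ?thesis using snoc.prems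
        by (intro exI[of _ "length B"] conjI exI[of _ "x - covered B"]) auto
    qed
  qed simp
  then show ?thesis using that by blast
qed

lemma g0_edges:
  assumes "is_PBP T B" "x < covered B"
  shows "g0 T B (Suc x) = Inl z \<longleftrightarrow> (\<exists>y. z = Suc y \<and> (x, y) \<in> edges B)"
proof -
  obtain p d where p: "p < length B" "d < plen (B ! p)" "x = covered (take p B) + d"
    using phrase_containing[OF assms(2)] .
  have uniq: "q = p \<and> d' = d" if "q < length B" "d' < plen (B ! q)" "x = covered (take q B) + d'"
    for q d'
  proof -
    have "q = p" using phrase_index_eq that p by metis
    then show ?thesis using that p by simp
  qed
  have pi: "phrase_index B (Suc x) = p" using p phrase_index_eq by blast
  have ok: "phrase_ok T (start B p) (B ! p)" using assms(1) p(1) by (auto simp: is_PBP_def)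
  show ?thesis
  proof (cases "B ! p")
    case (CharP c)
    have "(x, y) \<notin> edges B" for y
    proof
      assume "(x, y) \<in> edges B"
      then obtain q t l d' where "q < length B" "B ! q = TargetP t l" "d' < l"
        "x = covered (take q B) + d'"
        unfolding edges_def by auto
      then show False using uniq[of q d'] CharP by auto
    qed
    then show ?thesis by (simp add: g0_def pi CharP)
  next
    case (TargetP t l)
    have "t \<ge> 1" using ok TargetP by auto
    have "(x, y) \<in> edges B \<longleftrightarrow> y = t - 1 + d" for y
    proof
      assume "(x, y) \<in> edges B"
      then obtain q t' l' d' where "q < length B" "B ! q = TargetP t' l'" "d' < l'"
        "x = covered (take q B) + d'" "y = t' - 1 + d'"
        unfolding edges_def by auto
      then show "y = t - 1 + d" using uniq[of q d'] TargetP by auto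
    next
      assume "y = t - 1 + d"
      then show "(x, y) \<in> edges B" unfolding edges_def using p TargetP
        by (intro CollectI exI[of _ p] exI[of _ t] exI[of _ l] exI[of _ d]) auto
    qed
    moreover have "g0 T B (Suc x) = Inl (t + d)"
      unfolding g0_def pi Let_def by (simp add: TargetP start_def p(3))
    ultimately show ?thesis using \<open>t \<ge> 1\<close> by auto
  qed
qed

text \<open>\<open>g T B 0\<close> already follows one reference, so index \<open>k\<close>
  corresponds to a path with \<open>Suc k\<close> edges.\<close>

lemma g_edges:
  assumes "is_BP T B" "x < length T"
  shows "g T B k (Suc x) = Inl z \<longleftrightarrow> (\<exists>y. z = Suc y \<and> (x, y) \<in> edges B ^^ Suc k)"
proof (induction k arbitrary: z)
  case 0
  then show ?case using assms g0_edges[of T B x] by (auto simp: is_BP_def)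
next
  case (Suc k)
  have PBP: "is_PBP T B" "covered B = length T" using assms by (auto simp: is_BP_def)
  have less: "y < length T" if "(u, y) \<in> edges B ^^ Suc k" for u y
    using that PBP_edges[OF PBP(1)] by (auto elim: relpow_Suc_E)
  show ?case
  proof (cases "g T B k (Suc x)")
    case (Inl z')
    then obtain y where y: "z' = Suc y" "(x, y) \<in> edges B ^^ Suc k" using Suc.IH by auto
    have "(x, y') \<in> edges B ^^ Suc (Suc k) \<longleftrightarrow> (y, y') \<in> edges B" for y'
    proof
      assume "(x, y') \<in> edges B ^^ Suc (Suc k)"
      then obtain u where "(x, u) \<in> edges B ^^ Suc k" "(u, y') \<in> edges B"
        by (rule relpow_Suc_E)
      moreover from this(1) have "u = y"
        using Suc.IH[of "Suc u"] Inl y by auto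
      ultimately show "(y, y') \<in> edges B" by simp
    qed (use y in \<open>auto intro: relpow_Suc_I\<close>)
    then show ?thesis
      using g0_edges[OF PBP(1), of y z] less[OF y(2)] PBP(2) Inl y(1) by simp
  next
    case (Inr c)
    have "(x, y') \<notin> edges B ^^ Suc (Suc k)" for y'
      using Suc.IH Inr by (auto elim!: relpow_Suc_E[of _ _ "Suc k"] simp del: relpow.simps)
    then show ?thesis using Inr by simp
  qed
qed

section \<open>Validity and acyclicity\<close>

lemma relpow_rank:
  fixes rk :: "'a \<Rightarrow> nat"
  assumes "\<And>x y. (x, y) \<in> E \<Longrightarrow> rk y < rk x" "(x, y) \<in> E ^^ k"
  shows "k + rk y \<le> rk x"
  using assms(2)
proof (induction k arbitrary: y)
  case (Suc k)
  obtain z where "(x, z) \<in> E ^^ k" "(z, y) \<in> E" using Suc.prems by (rule relpow_Suc_E)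
  then show ?case using Suc.IH[of z] assms(1)[of z y] by linarith
qed simp

text \<open>Going round the cycle \<open>Suc k\<close> times gives a path of at least
  \<open>Suc k\<close> edges, and any initial part of a path is a path.\<close>

lemma relpow_cycle:
  assumes "(x, x) \<in> E\<^sup>+"
  shows "\<exists>y. (x, y) \<in> E ^^ k"
proof (induction k)
  case 0
  show ?case by (intro exI[of _ x]) simp
next
  case (Suc k)
  obtain l where l: "l > 0" "(x, x) \<in> E ^^ l" using assms by (auto simp: trancl_power)
  have "(x, x) \<in> E ^^ (l * i)" for i
    by (induction i) (use l(2) in \<open>auto simp: relpow_add\<close>)
  then have "(x, x) \<in> E ^^ (l * Suc k)" .
  moreover have "l * Suc k = Suc k + (l * Suc k - Suc k)" using l(1) by (cases l) auto
  ultimately have "(x, x) \<in> E ^^ Suc k O E ^^ (l * Suc k - Suc k)" by (metis relpow_add)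
  then show ?case by blast
qed

text \<open>A cycle admits paths of every length, in particular \<open>Suc n\<close> for the string
  length n. Without cycles, the number of positions reachable by a nonempty path drops along every
  edge and is at most n, so no path has \<open>Suc n\<close> edges; the n iterations in the
  definition of validity therefore detect every cycle.\<close>

lemma valid_BP_iff_acyclic:
  assumes "is_BP T B"
  shows "valid_BP T B \<longleftrightarrow> acyclic (edges B)"
proof -
  let ?n = "length T" and ?E = "edges B"
  have E: "?E \<subseteq> {..<?n} \<times> {..<?n}" using assms PBP_edges[of T B] by (auto simp: is_BP_def)
  have "valid_BP T B \<longleftrightarrow> (\<forall>x<?n. \<nexists>y. (x, y) \<in> ?E ^^ Suc ?n)"
  proof -
    have "(\<exists>c. g T B ?n (Suc x) = Inr c) \<longleftrightarrow> (\<nexists>y. (x, y) \<in> ?E ^^ Suc ?n)" if "x < ?n" for x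
      using g_edges[OF assms that, of ?n]
      by (cases "g T B ?n (Suc x)") (auto simp del: relpow.simps)
    moreover have "{1..?n} = Suc ` {..<?n}" by (simp add: image_Suc_lessThan)
    ultimately show ?thesis using assms by (auto simp: valid_BP_def simp del: relpow.simps)
  qed
  also have "\<dots> \<longleftrightarrow> acyclic ?E"
  proof
    assume none: "\<forall>x<?n. \<nexists>y. (x, y) \<in> ?E ^^ Suc ?n"
    show "acyclic ?E"
    proof (rule acyclicI, intro allI notI)
      fix x assume "(x, x) \<in> ?E\<^sup>+"
      moreover from this have "x < ?n" using E trancl_subset_Sigma[OF E] by auto
      ultimately show False using none relpow_cycle by metis
    qed
  next
    assume acyc: "acyclic ?E"
    define rk where "rk x = card {u. (x, u) \<in> ?E\<^sup>+}" for x
    have sub: "{u. (x, u) \<in> ?E\<^sup>+} \<subseteq> {..<?n}" for x using trancl_subset_Sigma[OF E] by auto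
    have dec: "rk y < rk x" if "(x, y) \<in> ?E" for x y
      unfolding rk_def
    proof (rule psubset_card_mono)
      show "finite {u. (x, u) \<in> ?E\<^sup>+}" using sub finite_subset by blast
      have "y \<notin> {u. (y, u) \<in> ?E\<^sup>+}" using acyc by (auto simp: acyclic_def)
      then show "{u. (y, u) \<in> ?E\<^sup>+} \<subset> {u. (x, u) \<in> ?E\<^sup>+}"
        using that by (auto intro: trancl_into_trancl2)
    qed
    show "\<forall>x<?n. \<nexists>y. (x, y) \<in> ?E ^^ Suc ?n"
    proof (intro allI impI notI, elim exE)
      fix x y assume "(x, y) \<in> ?E ^^ Suc ?n"
      from relpow_rank[of ?E rk x y "Suc ?n", OF dec this] have "Suc ?n \<le> rk x" by linarith
      moreover have "rk x \<le> ?n" using card_mono[OF _ sub, of x] by (simp add: rk_def)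
      ultimately show False by simp
    qed
  qed
  finally show ?thesis .
qed

lemma valid_PBP_iff: "valid_PBP T P \<longleftrightarrow> is_PBP T P \<and> acyclic (edges P)"
  unfolding valid_PBP_def using valid_BP_iff_acyclic BP_of_edges by metis

section \<open>Longest admissible references\<close>

lemma length_longest_common_prefix:
  "l \<le> length (longest_common_prefix xs ys) \<longleftrightarrow>
     l \<le> length xs \<and> l \<le> length ys \<and> (\<forall>d<l. xs ! d = ys ! d)"
proof (induction xs ys arbitrary: l rule: longest_common_prefix.induct)
  case (1 x xs y ys)
  show ?case
  proof (cases l)
    case (Suc k)
    then show ?thesis using 1[of k] by (auto simp: All_less_Suc2)
  qed simp
qed auto

text \<open>Positions are 0-based here and in the program, 1-based in the phrases.\<close>

definition extendable :: "'a list \<Rightarrow> 'a phrase list \<Rightarrow> nat \<Rightarrow> nat \<Rightarrow> bool" where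
  "extendable T P j l \<longleftrightarrow> 1 \<le> l \<and> j \<noteq> covered P \<and> covered P + l \<le> length T \<and> j + l \<le> length T \<and>
     (\<forall>d<l. T ! (covered P + d) = T ! (j + d)) \<and>
     acyclic (edges P \<union> {(covered P + d, j + d) | d. d < l})"

lemma extendable_iff:
  assumes "is_PBP T P" "covered P < length T" "j < length T"
  shows "extendable T P j l \<longleftrightarrow>
    l \<in> {1..lcp T (Suc (covered P)) (Suc j)} \<and> valid_PBP T (P @ [TargetP (Suc j) l])"
proof -
  let ?i = "covered P"
  have sub: "substr T (Suc a) (length T) = drop a T" for a by (simp add: substr_def)
  have lcp: "l \<le> lcp T (Suc ?i) (Suc j) \<longleftrightarrow>
      ?i + l \<le> length T \<and> j + l \<le> length T \<and> (\<forall>d<l. T ! (?i + d) = T ! (j + d))"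
    unfolding lcp_def sub length_longest_common_prefix using assms by (auto simp: nth_drop)
  have "take l (drop j T) = take l (drop ?i T)"
    if "?i + l \<le> length T" "j + l \<le> length T" "\<forall>d<l. T ! (?i + d) = T ! (j + d)"
    using that by (intro nth_equalityI) auto
  then show ?thesis
    unfolding valid_PBP_iff extendable_def atLeastAtMost_iff lcp is_PBP_snoc edges_snoc_Target
    using assms by (auto simp: substr_def)
qed

lemma extendable_mono:
  assumes "extendable T P j l" "1 \<le> k" "k \<le> l"
  shows "extendable T P j k"
proof -
  have "edges P \<union> {(covered P + d, j + d) | d. d < k} \<subseteq> edges P \<union> {(covered P + d, j + d) | d. d < l}"
    using assms(3) by auto
  then show ?thesis using assms unfolding extendable_def by (auto intro: acyclic_subset)
qed

lemma LF_extendable: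
  assumes "is_PBP T P" "covered P < length T" "j < length T"
  shows "LF T P (Suc j) = Max ({0} \<union> {l. extendable T P j l})"
    "finite {l. extendable T P j l}"
proof -
  have eq: "{l. extendable T P j l} = {l \<in> {1..lcp T (Suc (covered P)) (Suc j)}.
      valid_PBP T (P @ [TargetP (Suc j) l])}"
    using extendable_iff[OF assms] by auto
  show "LF T P (Suc j) = Max ({0} \<union> {l. extendable T P j l})" unfolding LF_def eq ..
  show "finite {l. extendable T P j l}" unfolding eq by simp
qed

lemma extendable_le_maxLF:
  assumes "is_PBP T P" "covered P < length T" "extendable T P j l"
  shows "l \<le> maxLF T P"
proof -
  have j: "j < length T" using assms(3) by (auto simp: extendable_def)
  have "l \<le> LF T P (Suc j)"
    unfolding LF_extendable(1)[OF assms(1,2) j]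
    using LF_extendable(2)[OF assms(1,2) j] assms(3) by (intro Max_ge) auto
  also have "\<dots> \<le> maxLF T P" unfolding maxLF_def using j by (intro Max_ge) auto
  finally show ?thesis .
qed

text \<open>Tailored to the exit of the search: the best length found is attained, and no candidate
  reaches one more. By \<open>extendable_mono\<close> the latter excludes all greater lengths
  too.\<close>

lemma maxLF_eqI:
  assumes P: "is_PBP T P" "covered P < length T"
    and ext: "M > 0 \<longrightarrow> extendable T P j M"
    and max: "\<And>j. j < length T \<Longrightarrow> \<not> extendable T P j (Suc M)"
  shows "maxLF T P = M" "M > 0 \<Longrightarrow> LF T P (Suc j) = M"
proof -
  have le: "LF T P (Suc j') \<le> M" if "j' < length T" for j'
  proof -
    have "l \<le> M" if "extendable T P j' l" for l
      using max[OF \<open>j' < length T\<close>] extendable_mono[OF that, of "Suc M"] by (cases "l \<le> M") auto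
    then show ?thesis
      unfolding LF_extendable(1)[OF P that] using LF_extendable(2)[OF P that] by simp
  qed
  have "maxLF T P \<le> M"
    unfolding maxLF_def
  proof (subst Max_le_iff)
    show "\<forall>a\<in>LF T P ` {1..length T}. a \<le> M"
    proof (intro ballI)
      fix a assume "a \<in> LF T P ` {1..length T}"
      then have "a \<in> LF T P ` Suc ` {..<length T}" by (simp add: image_Suc_lessThan)
      then obtain j' where "a = LF T P (Suc j')" "j' < length T" by blast
      then show "a \<le> M" using le by simp
    qed
  qed (use P(2) in auto)
  then show M: "maxLF T P = M"
    using extendable_le_maxLF[OF P] ext by (cases "M > 0") (auto intro: le_antisym)
  assume "M > 0"
  then have "extendable T P j M" "j < length T" using ext by (auto simp: extendable_def)
  then have "M \<le> LF T P (Suc j)"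
    unfolding LF_extendable(1)[OF P \<open>j < length T\<close>]
    using LF_extendable(2)[OF P \<open>j < length T\<close>] by (intro Max_ge) auto
  then show "LF T P (Suc j) = M" using le[OF \<open>j < length T\<close>] by simp
qed

section \<open>Contraction of a forest to its roots\<close>

text \<open>With at most one successor per node, termination at the end of a path passes back along
  it; a second successor could otherwise start an infinite path.\<close>

lemma acc_converse_rtrancl:
  assumes "single_valued E" "(x, y) \<in> E\<^sup>*" "y \<in> termi E"
  shows "x \<in> termi E"
  using assms(2,3)
proof (induction rule: converse_rtrancl_induct)
  case (step x z)
  show ?case
  proof (rule acc.accI)
    fix u assume "(u, x) \<in> E\<inverse>"
    then have "u = z" using step.hyps(1) assms(1) by (auto dest: single_valuedD)
    then show "u \<in> termi E" using step by simp
  qed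
qed

text \<open>A path that leaves \<open>x\<close> in \<open>I\<close> goes to \<open>f x\<close> and
  then, by single-valuedness, along old edges to \<open>\<rho> x\<close>, where it stops or has
  reached \<open>I\<close> again. A cycle must meet \<open>I\<close> since \<open>E\<close> is
  acyclic, so it shows up among the contracted edges. The proof argues by termination instead of
  cycles, finiteness turning acyclicity into well-foundedness.\<close>

lemma acyclic_contraction:
  fixes E :: "('a \<times> 'a) set" and \<rho> f :: "'a \<Rightarrow> 'a"
  assumes E: "finite E" "acyclic E" "single_valued E"
    and I: "finite I" "I \<inter> Domain E = {}"
    and \<rho>: "\<And>x. x \<in> I \<Longrightarrow> (f x, \<rho> x) \<in> E\<^sup>* \<and> \<rho> x \<notin> Domain E"
  shows "acyclic (E \<union> {(x, f x) | x. x \<in> I}) \<longleftrightarrow> acyclic {(x, \<rho> x) | x. x \<in> I}"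
    (is "acyclic ?F \<longleftrightarrow> acyclic ?r")
proof
  assume acyc: "acyclic ?F"
  have "?r \<subseteq> ?F\<^sup>+"
  proof clarify
    fix x assume x: "x \<in> I"
    have "(f x, \<rho> x) \<in> ?F\<^sup>*" using \<rho>[OF x] rtrancl_mono[of E ?F] by auto
    moreover have "(x, f x) \<in> ?F" using x by auto
    ultimately show "(x, \<rho> x) \<in> ?F\<^sup>+" by (rule rtrancl_into_trancl2[rotated])
  qed
  then have "?r\<^sup>+ \<subseteq> ?F\<^sup>+" using trancl_mono_subset[of ?r "?F\<^sup>+"] by simp
  then show "acyclic ?r" using acyc unfolding acyclic_def by blast
next
  assume acyc: "acyclic ?r"
  have sv: "single_valued ?F"
  proof (rule single_valuedI)
    fix x y z assume "(x, y) \<in> ?F" "(x, z) \<in> ?F"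
    then show "y = z" using I(2) E(3) by (auto dest: single_valuedD)
  qed
  have "wf (?r\<inverse>)"
  proof (rule finite_acyclic_wf_converse[OF _ acyc])
    have "?r = (\<lambda>x. (x, \<rho> x)) ` I" by auto
    then show "finite ?r" using I(1) by simp
  qed
  \<comment> \<open>Old roots, by induction along the contracted edges; the old path in between is
    bridged by \<open>acc_converse_rtrancl\<close>.\<close>
  then have root: "x \<notin> Domain E \<Longrightarrow> x \<in> termi ?F" for x
  proof (induction x rule: wf_induct_rule)
    case (less x)
    have *: "y \<in> termi ?F" if "(x, y) \<in> ?F" for y
    proof -
      have x: "x \<in> I" "y = f x" using that less.prems by auto
      then have "\<rho> x \<in> termi ?F" using \<rho> by (intro less.IH) auto
      moreover have "(y, \<rho> x) \<in> ?F\<^sup>*" using \<rho>[OF x(1)] x(2) rtrancl_mono[of E ?F] by auto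
      ultimately show ?thesis using acc_converse_rtrancl[OF sv] by blast
    qed
    show ?case by (rule acc.accI) (rule *, erule converseD)
  qed
  have "wf (E\<inverse>)" using E by (simp add: finite_acyclic_wf_converse)
  \<comment> \<open>The remaining positions, by induction along \<open>E\<close>: by disjointness
    their only outgoing edges are old.\<close>
  then have "x \<in> termi ?F" for x
  proof (induction x rule: wf_induct_rule)
    case (less x)
    show ?case
    proof (cases "x \<in> Domain E")
      case True
      then have *: "y \<in> termi ?F" if "(x, y) \<in> ?F" for y
        using that less.IH I(2) by auto
      show ?thesis by (rule acc.accI) (rule *, erule converseD)
    qed (rule root)
  qed
  then have "wf (?F\<inverse>)" by (intro acc_wfI allI)
  then show "acyclic ?F" using wf_acyclic[of "?F\<inverse>"] by simp
qed

lemma termi_not_Domain: "y \<notin> Domain r \<Longrightarrow> y \<in> termi r"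
  by (rule acc.accI) auto

text \<open>Nodes without successor terminate trivially, so only those in the domain need a
  certificate; the stamped walks provide it.\<close>

lemma acyclic_if_termi:
  assumes "Domain r \<subseteq> termi r"
  shows "acyclic r"
proof -
  have "x \<in> termi r" for x using assms termi_not_Domain[of x r] by blast
  then have "wf (r\<inverse>)" by (intro acc_wfI allI)
  then show ?thesis using wf_acyclic[of "r\<inverse>"] by simp
qed

lemma extendable_maxLF:
  assumes "is_PBP T P" "covered P < length T" "maxLF T P > 0"
  obtains j where "extendable T P j (maxLF T P)"
proof -
  have "maxLF T P \<in> LF T P ` {1..length T}"
    unfolding maxLF_def using assms(2) by (intro Max_in) auto
  then have "maxLF T P \<in> LF T P ` Suc ` {..<length T}" by (simp add: image_Suc_lessThan)
  then obtain j where j: "j < length T" "maxLF T P = LF T P (Suc j)" by blast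
  have "LF T P (Suc j) \<in> {0} \<union> {l. extendable T P j l}"
    unfolding LF_extendable(1)[OF assms(1,2) j(1)]
    using LF_extendable(2)[OF assms(1,2) j(1)] by (intro Max_in) auto
  then show thesis using that[of j] j(2) assms(3) by auto
qed

lemma covered_maxLF:
  assumes "is_PBP T P" "covered P < length T"
  shows "covered P + maxLF T P \<le> length T"
proof (cases "maxLF T P > 0")
  case True
  then show ?thesis using extendable_maxLF[OF assms] by (auto simp: extendable_def)
qed (use assms in simp)

lemma take_two_updates:
  assumes "Suc c < length xs"
  shows "take (Suc (Suc c)) (xs[c := a, Suc c := b]) = take c xs @ [a, b]"
  using assms by (simp add: take_Suc_conv_app_nth)

section \<open>The program\<close>

text \<open>Registers 0 and 1 are dictated by the input and output conventions. \<open>rI\<close> is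
  the start of the next phrase, \<open>rJ\<close> the candidate source, \<open>rM\<close> and
  \<open>rJs\<close> the best length and its source, \<open>rE\<close> the exclusive end of the
  interval considered, \<open>rMark\<close> and \<open>rOut\<close> the addresses of the stamps and
  of the next output cell; \<open>rOk\<close> holds a verdict, \<open>rGo\<close> a loop flag, and
  the rest are working registers.\<close>

abbreviation (input) "rN \<equiv> 0 :: nat"
abbreviation (input) "rCnt \<equiv> 1 :: nat"
abbreviation (input) "rZero \<equiv> 2 :: nat"
abbreviation (input) "rOne \<equiv> 3 :: nat"
abbreviation (input) "rMark \<equiv> 4 :: nat"
abbreviation (input) "rOut \<equiv> 5 :: nat"
abbreviation (input) "rI \<equiv> 6 :: nat"
abbreviation (input) "rJ \<equiv> 7 :: nat"
abbreviation (input) "rM \<equiv> 8 :: nat"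
abbreviation (input) "rJs \<equiv> 9 :: nat"
abbreviation (input) "rX \<equiv> 10 :: nat"
abbreviation (input) "rY \<equiv> 11 :: nat"
abbreviation (input) "rOk \<equiv> 12 :: nat"
abbreviation (input) "rGo \<equiv> 13 :: nat"
abbreviation (input) "rE \<equiv> 14 :: nat"
abbreviation (input) "rA \<equiv> 15 :: nat"
abbreviation (input) "rB \<equiv> 16 :: nat"

text \<open>The comparison loop also clears the stamps of the interval, so that a trial never has to
  reset all n of them. A mismatch only lowers the verdict and does not leave the loop.\<close>

definition match_step :: com where
  "match_step =
     Basic (Load rA rX) ;; Basic (Load rB rY) ;;
     Cond (EqC rA rB) Skip (Basic (Move rOk rZero)) ;;
     Basic (Op Add rA rMark rX) ;; Basic (Store rA rZero) ;;
     Basic (Op Add rX rX rOne) ;; Basic (Op Add rY rY rOne)"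

definition match_code :: com where
  "match_code = Basic (Move rX rI) ;; Basic (Move rY rJ) ;; Loop (LessC rX rE) match_step"

text \<open>A walk stamps the positions it visits with the value of \<open>rX\<close>; meeting a stamp of its own
  closes a cycle.\<close>

definition walk_step :: com where
  "walk_step =
     Basic (Move rGo rZero) ;;
     Cond (LessC rY rI) Skip
       (Cond (LessC rY rE)
         (Basic (Op Add rA rMark rY) ;; Basic (Load rB rA) ;;
          Cond (EqC rB rZero)
            (Basic (Store rA rX) ;;
             Basic (Op Add rA rY rJ) ;; Basic (Op Sub rA rA rI) ;; Basic (Op Add rA rN rA) ;;
             Basic (Load rY rA) ;; Basic (Move rGo rOne))
            (Cond (EqC rB rX) (Basic (Move rOk rZero)) Skip))
         Skip)"

abbreviation walk_code :: com where
  "walk_code \<equiv> Loop (EqC rGo rOne) walk_step"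

text \<open>\<open>rX\<close> is incremented before the walk: the walk from \<open>x\<close> stamps
  with \<open>x + 1\<close>, so 0 stays reserved for unvisited positions and stamps of earlier walks
  of the trial are smaller.\<close>

definition cycle_code :: com where
  "cycle_code =
     Basic (Move rX rI) ;;
     Loop (LessC rX rE)
       (Basic (Move rY rX) ;; Basic (Op Add rX rX rOne) ;; Basic (Move rGo rOne) ;; walk_code)"

text \<open>Range tests come first because an out-of-range load gets the machine stuck; the later
  stages run only if the verdict so far is positive. The trial has length \<open>M + 1\<close>,
  whence the extra increment of \<open>rE\<close>.\<close>

definition check_code :: com where
  "check_code =
     (Basic (Move rOk rOne) ;; Basic (Op Add rE rI rM) ;; Basic (Op Add rE rE rOne) ;;
      Cond (EqC rI rJ) (Basic (Move rOk rZero)) Skip ;;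
      Cond (LessC rN rE) (Basic (Move rOk rZero)) Skip ;;
      Basic (Op Add rA rJ rM) ;;
      Cond (LessC rA rN) Skip (Basic (Move rOk rZero))) ;;
     Cond (EqC rOk rOne) match_code Skip ;;
     Cond (EqC rOk rOne) cycle_code Skip"

definition search_step :: com where
  "search_step =
     check_code ;;
     Cond (EqC rOk rOne)
       (Basic (Op Add rM rM rOne) ;; Basic (Move rJs rJ))
       (Basic (Op Add rJ rJ rOne))"

definition search_code :: com where
  "search_code =
     Basic (Move rM rZero) ;; Basic (Move rJ rZero) ;; Loop (LessC rJ rN) search_step"

text \<open>The counterpart of \<open>walk_step\<close> for an accepted phrase: no stamps, because
  the extended graph is known to be acyclic, and the source is \<open>rJs\<close> instead of
  \<open>rJ\<close>.\<close>

definition climb_step :: com where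
  "climb_step =
     Basic (Move rGo rZero) ;;
     Cond (LessC rY rI) Skip
       (Cond (LessC rY rE)
         (Basic (Op Add rA rY rJs) ;; Basic (Op Sub rA rA rI) ;; Basic (Op Add rA rN rA) ;;
          Basic (Load rY rA) ;; Basic (Move rGo rOne))
         Skip)"

definition update_step :: com where
  "update_step =
     (Basic (Op Add rA rN rX) ;; Basic (Load rY rA) ;; Basic (Move rGo rOne)) ;;
     Loop (EqC rGo rOne) climb_step ;;
     Basic (Op Add rA rN rX) ;; Basic (Store rA rY) ;; Basic (Op Add rX rX rOne)"

definition update_code :: com where
  "update_code =
     Basic (Op Add rE rI rM) ;; Basic (Move rX rZero) ;; Loop (LessC rX rN) update_step"

definition emit_code :: com where
  "emit_code =
     Cond (EqC rM rZero)
       (Basic (Store rOut rM) ;; Basic (Op Add rOut rOut rOne) ;;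
        Basic (Load rA rI) ;; Basic (Store rOut rA) ;;
        Basic (Op Add rI rI rOne) ;;
        Basic (Op Add rOut rOut rOne) ;; Basic (Op Add rCnt rCnt rOne))
       (update_code ;;
        Basic (Store rOut rM) ;; Basic (Op Add rOut rOut rOne) ;;
        Basic (Op Add rA rJs rOne) ;; Basic (Store rOut rA) ;;
        Basic (Op Add rI rI rM) ;;
        Basic (Op Add rOut rOut rOne) ;; Basic (Op Add rCnt rCnt rOne))"

text \<open>Without references every position is its own root. Stamps, the phrase counter and
  \<open>rI\<close> start as 0 because memory and registers do.\<close>

definition init_code :: com where
  "init_code =
     Basic (Const rOne 1) ;; Basic (Op Add rMark rN rN) ;; Basic (Op Add rOut rMark rN) ;;
     Loop (LessC rX rN)
       (Basic (Op Add rA rN rX) ;; Basic (Store rA rX) ;; Basic (Op Add rX rX rOne))"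

text \<open>The closing addition puts the output address 3n into register 0.\<close>

definition lzrr_code :: com where
  "lzrr_code =
     init_code ;; Loop (LessC rI rN) (search_code ;; emit_code) ;; Basic (Op Add rN rMark rN)"

section \<open>Correctness and running time\<close>

text \<open>The program forms \<open>y + j\<close> before subtracting \<open>i\<close>, so with
  \<open>i \<le> y\<close> the subtraction does not wrap around, even if
  \<open>j < i\<close>.\<close>

lemma word_sub: "b \<le> a \<Longrightarrow> a < 2 ^ w \<Longrightarrow> (a + 2 ^ w - b) mod 2 ^ w = (a - b :: nat)"
  by (metis Nat.add_diff_assoc2 add.commute less_imp_diff_less mod_add_self2 mod_less)

section \<open>Memory layout and register invariants\<close>

text \<open>Every address and intermediate sum of the program stays below this bound, so machine
  arithmetic agrees with that of natural numbers.\<close>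

locale word_ram_input =
  fixes T :: "'a::linorder list" and w :: nat
  assumes big: "6 * length T + 6 < (2::nat) ^ w"
begin

abbreviation "n \<equiv> length T"

text \<open>\<open>rt\<close> holds the roots and \<open>mk\<close> the stamps; with both of length
  n, the output array starts at address 3n.\<close>

definition layout :: "nat list \<Rightarrow> nat list \<Rightarrow> 'a cell list \<Rightarrow> 'a cell list" where
  "layout rt mk out = map Sym T @ map Word rt @ map Word mk @ out"

lemma layout_length [simp]: "length (layout rt mk out) = n + length rt + length mk + length out"
  by (simp add: layout_def)

lemma layout_nth [simp]:
  "x < n \<Longrightarrow> layout rt mk out ! x = Sym (T ! x)"
  "length rt = n \<Longrightarrow> x < n \<Longrightarrow> layout rt mk out ! (n + x) = Word (rt ! x)"
  "length rt = n \<Longrightarrow> length mk = n \<Longrightarrow> x < n \<Longrightarrow> layout rt mk out ! (2 * n + x) = Word (mk ! x)"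
  by (auto simp: layout_def nth_append)

lemma layout_nth_diff [simp]:
  "length rt = n \<Longrightarrow> b \<le> a \<Longrightarrow> a - b < n \<Longrightarrow> layout rt mk out ! (n + a - b) = Word (rt ! (a - b))"
  using layout_nth(2)[of rt "a - b"] by simp

lemma layout_update [simp]:
  "length rt = n \<Longrightarrow> x < n \<Longrightarrow> (layout rt mk out)[n + x := Word v] = layout (rt[x := v]) mk out"
  "length rt = n \<Longrightarrow> length mk = n \<Longrightarrow> x < n \<Longrightarrow>
    (layout rt mk out)[2 * n + x := Word v] = layout rt (mk[x := v]) out"
  "length rt = n \<Longrightarrow> length mk = n \<Longrightarrow> (layout rt mk out)[3 * n + x := c] = layout rt mk (out[x := c])"
  "length rt = n \<Longrightarrow> length mk = n \<Longrightarrow>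
    (layout rt mk out)[Suc (3 * n + x) := c] = layout rt mk (out[Suc x := c])"
  by (auto simp: layout_def list_update_append map_update)

text \<open>Only the registers that outlive a subroutine; the others are left free, so that updates
  to them preserve the predicate.\<close>

definition regs_ok :: "(nat \<Rightarrow> 'a cell) \<Rightarrow> nat \<Rightarrow> nat \<Rightarrow> nat \<Rightarrow> nat \<Rightarrow> nat \<Rightarrow> bool" where
  "regs_ok R cnt i j M js \<longleftrightarrow> R rN = Word n \<and> R rCnt = Word cnt \<and> R rZero = Word 0 \<and>
     R rOne = Word 1 \<and> R rMark = Word (2 * n) \<and> R rOut = Word (3 * n + 2 * cnt) \<and> R rI = Word i \<and>
     R rJ = Word j \<and> R rM = Word M \<and> R rJs = Word js"

text \<open>A conclusion of the form \<open>k \<le> k' + c\<close> bounds the steps used, which lets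
  callers add up costs. The cleared stamps are part of the result because the cycle search starts
  from them.\<close>

lemma match_code:
  assumes regs: "regs_ok R cnt i j M js" "R rE = Word (Suc (i + M))" "R rOk = Word 1"
    and len: "length rt = n" "length mk = n" "i + M < n" "j + M < n"
    and m: "m = layout rt mk out"
    and k: "16 * M + 30 \<le> k"
  shows "vc w match_code (\<lambda>R' m' k'. regs_ok R' cnt i j M js \<and> R' rE = Word (Suc (i + M)) \<and>
      R' rOk = Word (if \<forall>d<Suc M. T ! (i + d) = T ! (j + d) then 1 else 0) \<and>
      (\<exists>mk'. m' = layout rt mk' out \<and> length mk' = n \<and> (\<forall>z\<in>{i..i + M}. mk' ! z = 0)) \<and>
      k \<le> k' + (16 * M + 30)) R m k" (is "vc _ _ ?Q _ _ _")
proof -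
  define I where "I R' m' k' \<longleftrightarrow> (\<exists>d mk'. d \<le> Suc M \<and> regs_ok R' cnt i j M js \<and>
      R' rE = Word (Suc (i + M)) \<and>
      R' rOk = Word (if \<forall>d'<d. T ! (i + d') = T ! (j + d') then 1 else 0) \<and>
      R' rX = Word (i + d) \<and> R' rY = Word (j + d) \<and>
      m' = layout rt mk' out \<and> length mk' = n \<and> (\<forall>z\<in>{i..<i + d}. mk' ! z = 0) \<and>
      k \<le> k' + (16 * d + 2))" for R' m' k'
  define Q where "Q = ?Q"
  have loop: "vc w (Loop (LessC rX rE) match_step) Q R' m' k'" if "I R' m' k'" for R' m' k'
    using that
  proof (rule vc_loopI[where I = I])
    fix R' m' k'
    assume "I R' m' k'"
    then obtain d mk' where d: "d \<le> Suc M" and rg: "regs_ok R' cnt i j M js"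
      "R' rE = Word (Suc (i + M))"
      "R' rOk = Word (if \<forall>d'<d. T ! (i + d') = T ! (j + d') then 1 else 0)"
      "R' rX = Word (i + d)" "R' rY = Word (j + d)"
      and m': "m' = layout rt mk' out" "length mk' = n" "\<forall>z\<in>{i..<i + d}. mk' ! z = 0"
      and k': "k \<le> k' + (16 * d + 2)"
      unfolding I_def by blast
    show "2 \<le> k' \<and> holds (LessC rX rE) R' \<noteq> None" using rg k k' d by simp
    {
      assume "holds (LessC rX rE) R' = Some False"
      then have "d = Suc M" using rg d by simp
      then show "Q R' m' (k' - 2)"
        unfolding Q_def using rg m' k' k by (intro conjI exI[of _ mk']) (simp_all add: less_Suc_eq_le)
    }
    assume "holds (LessC rX rE) R' = Some True"
    then have "d \<le> M" using rg d by simp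
    \<comment> \<open>Splitting off a numeral makes the truncated subtractions in the step count
      exact.\<close>
    moreover from this obtain c where c: "k' = 12 + c"
      using k k' le_Suc_ex[of 12 k'] by auto
    ultimately show "vc w match_step I R' m' (k' - 2)"
      using rg(2-5) m'(1,2) len big rg(1)[unfolded regs_ok_def]
      by (simp add: match_step_def,
          intro conjI impI; unfold I_def; intro exI[of _ "Suc d"] exI[of _ "mk'[i + d := 0]"])
        (use k' c m'(3) in \<open>simp_all add: regs_ok_def All_less_Suc nth_list_update\<close>)
  qed
  obtain c where c: "k = 30 + c" using k le_Suc_ex[of 30 k] by auto
  have "I (R(rX := Word i, rY := Word j)) m (28 + c)"
    unfolding I_def using regs len c
    by (intro exI[of _ 0] exI[of _ mk]) (simp add: m regs_ok_def)
  from loop[OF this] show ?thesis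
    unfolding match_code_def Q_def[symmetric] using regs c by (simp add: regs_ok_def)
qed

section \<open>Cycle detection by stamped walks\<close>

text \<open>The contracted graph of \<open>acyclic_contraction\<close> for a trial of length
  \<open>M + 1\<close>.\<close>

definition hops :: "nat list \<Rightarrow> nat \<Rightarrow> nat \<Rightarrow> nat \<Rightarrow> (nat \<times> nat) set" where
  "hops rt i j M = {(x, rt ! (x + j - i)) | x. x \<in> {i..i + M}}"

lemma single_valued_hops: "single_valued (hops rt i j M)"
  by (auto simp: hops_def single_valued_def)

lemma Domain_hops: "Domain (hops rt i j M) = {i..i + M}"
  by (auto simp: hops_def)

text \<open>What is known once the positions in \<open>A\<close> have been stamped: verdict 0 is a
  definite no, verdict 1 certifies only the positions in \<open>A\<close>. The first alternative
  does not mention \<open>A\<close>, so walks may go on after a cycle has been found.\<close>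

definition status :: "nat \<Rightarrow> (nat \<times> nat) set \<Rightarrow> nat set \<Rightarrow> bool" where
  "status ok r A \<longleftrightarrow> ok = 0 \<and> \<not> acyclic r \<or> ok = 1 \<and> A \<subseteq> termi r"

text \<open>Whatever carries the current stamp leads to \<open>y\<close>. Under verdict 1,
  \<open>y\<close> terminates, being a sink or certified by an earlier walk, so the current walk
  joins the certified positions.\<close>

lemma status_walk_end:
  assumes "status ok r {z \<in> D. mk ! z \<noteq> 0 \<and> mk ! z \<noteq> s}" "single_valued r"
    "\<forall>z\<in>D. mk ! z = s \<longrightarrow> (z, y) \<in> r\<^sup>+"
    "y \<notin> Domain r \<or> y \<in> D \<and> mk ! y \<noteq> 0 \<and> mk ! y \<noteq> s"
  shows "status ok r {z \<in> D. mk ! z \<noteq> 0}"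
proof -
  have "{z \<in> D. mk ! z \<noteq> 0} \<subseteq> termi r" if old: "{z \<in> D. mk ! z \<noteq> 0 \<and> mk ! z \<noteq> s} \<subseteq> termi r"
  proof
    fix z assume z: "z \<in> {z \<in> D. mk ! z \<noteq> 0}"
    have y: "y \<in> termi r" using assms(4) old termi_not_Domain[of y r] by blast
    show "z \<in> termi r"
    proof (cases "mk ! z = s")
      case True
      then have "(z, y) \<in> r\<^sup>*" using z assms(3) by (auto intro: trancl_into_rtrancl)
      then show ?thesis using y acc_converse_rtrancl[OF assms(2)] by blast
    qed (use z old in blast)
  qed
  then show ?thesis using assms(1) by (auto simp: status_def)
qed

text \<open>The number of unstamped positions serves as a potential: every step that continues the
  walk stamps a new one and releases 25, and 30 pays for the end. All walks together are thus linear
  in the interval, although a single one may be long.\<close>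

lemma walk_code:
  fixes rt mk i j M
  defines "r \<equiv> hops rt i j M"
    and "unmarked \<equiv> \<lambda>mk. card {z \<in> {i..i + M}. mk ! z = (0 :: nat)}"
  assumes regs: "regs_ok R cnt i j M js" "R rE = Word (Suc (i + M))" "R rX = Word (Suc x)"
      "R rY = Word x" "R rGo = Word 1" "R rOk = Word ok"
    and len: "length rt = n" "length mk = n" "i + M < n" "j + M < n" "\<forall>y<n. rt ! y < n"
    and x: "x \<in> {i..i + M}" "\<forall>z\<in>{i..i + M}. mk ! z \<le> x"
    and st: "status ok r {z \<in> {i..i + M}. mk ! z \<noteq> 0}"
    and m: "m = layout rt mk out"
    and k: "25 * unmarked mk + 30 \<le> k"
  shows "vc w walk_code (\<lambda>R' m' k'. regs_ok R' cnt i j M js \<and> R' rE = Word (Suc (i + M)) \<and>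
      R' rX = Word (Suc x) \<and> (\<exists>mk' ok'. R' rOk = Word ok' \<and> m' = layout rt mk' out \<and> length mk' = n \<and>
        mk' ! x \<noteq> 0 \<and> (\<forall>z\<in>{i..i + M}. mk ! z \<noteq> 0 \<longrightarrow> mk' ! z \<noteq> 0) \<and>
        (\<forall>z\<in>{i..i + M}. mk' ! z \<le> Suc x) \<and> status ok' r {z \<in> {i..i + M}. mk' ! z \<noteq> 0} \<and>
        k + 25 * unmarked mk' \<le> k' + 25 * unmarked mk + 30)) R m k"
    (is "vc _ _ ?Q _ _ _")
proof -
  let ?D = "{i..i + M}"
  \<comment> \<open>While the walk runs (\<open>go = 1\<close>), positions with its own stamp
    \<open>Suc x\<close> have a nonempty path to the current \<open>y\<close>, and
    \<open>status\<close> covers those with older stamps. Once it has stopped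
    (\<open>go = 0\<close>), \<open>status\<close> covers all stamped positions.\<close>
  define inv where "inv mk' y ok' go k' \<longleftrightarrow> length mk' = n \<and> y < n \<and> (y = x \<or> mk' ! x \<noteq> 0) \<and>
      (\<forall>z\<in>?D. mk ! z \<noteq> 0 \<longrightarrow> mk' ! z \<noteq> 0) \<and> (\<forall>z\<in>?D. mk' ! z \<le> Suc x) \<and>
      (go = 1 \<and> status ok' r {z \<in> ?D. mk' ! z \<noteq> 0 \<and> mk' ! z \<noteq> Suc x} \<and>
         (\<forall>z\<in>?D. mk' ! z = Suc x \<longrightarrow> (z, y) \<in> r\<^sup>+) \<and>
         k + 25 * unmarked mk' \<le> k' + 25 * unmarked mk \<or>
       go = 0 \<and> mk' ! x \<noteq> 0 \<and> status ok' r {z \<in> ?D. mk' ! z \<noteq> 0} \<and>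
         k + 25 * unmarked mk' \<le> k' + 25 * unmarked mk + 23)" for mk' y ok' and go :: nat and k'
  define I where "I R' m' k' \<longleftrightarrow> (\<exists>mk' y ok' go. regs_ok R' cnt i j M js \<and>
      R' rE = Word (Suc (i + M)) \<and> R' rX = Word (Suc x) \<and> R' rY = Word y \<and> R' rGo = Word go \<and>
      R' rOk = Word ok' \<and> m' = layout rt mk' out \<and> inv mk' y ok' go k')" for R' m' k'
  define Q where "Q = ?Q"
  have sv: "single_valued r" and Dom: "Domain r = ?D"
    by (simp_all add: r_def single_valued_hops Domain_hops)
  have "vc w walk_code Q R m k"
  proof (rule vc_loopI[where I = I])
    have "\<forall>z\<in>?D. mk ! z \<noteq> Suc x" using x(2) by fastforce
    moreover from this have "{z \<in> ?D. mk ! z \<noteq> 0 \<and> mk ! z \<noteq> Suc x} = {z \<in> ?D. mk ! z \<noteq> 0}"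
      by auto
    ultimately have "inv mk x ok 1 k"
      unfolding inv_def using st x len by auto
    then show "I R m k" unfolding I_def using regs m by blast
  next
    fix R' m' k'
    assume "I R' m' k'"
    then obtain mk' y ok' go where rg: "regs_ok R' cnt i j M js"
      "R' rE = Word (Suc (i + M))" "R' rX = Word (Suc x)" "R' rY = Word y" "R' rGo = Word go"
      "R' rOk = Word ok'"
      and m': "m' = layout rt mk' out" and inv: "inv mk' y ok' go k'"
      unfolding I_def by blast
    have one: "R' rOne = Word 1" using rg(1) by (simp add: regs_ok_def)
    show "2 \<le> k' \<and> holds (EqC rGo rOne) R' \<noteq> None"
      using inv k rg(5) one unfolding inv_def by auto
    {
      assume "holds (EqC rGo rOne) R' = Some False"
      then have "go \<noteq> 1" using rg one by simp
      then show "Q R' m' (k' - 2)"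
        unfolding Q_def using rg m' inv
        by (intro conjI exI[of _ mk'] exI[of _ ok']) (auto simp: inv_def)
    }
    assume "holds (EqC rGo rOne) R' = Some True"
    then have go: "go = 1" using rg one by simp
    then have "30 \<le> k'" using inv k by (auto simp: inv_def)
    then obtain c where c: "k' = 30 + c" using le_Suc_ex by blast
    have inv': "length mk' = n" "y < n" "y = x \<or> mk' ! x \<noteq> 0"
      "\<forall>z\<in>?D. mk ! z \<noteq> 0 \<longrightarrow> mk' ! z \<noteq> 0" "\<forall>z\<in>?D. mk' ! z \<le> Suc x"
      "status ok' r {z \<in> ?D. mk' ! z \<noteq> 0 \<and> mk' ! z \<noteq> Suc x}"
      "\<forall>z\<in>?D. mk' ! z = Suc x \<longrightarrow> (z, y) \<in> r\<^sup>+"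
      "k + 25 * unmarked mk' \<le> k' + 25 * unmarked mk"
      using inv go by (auto simp: inv_def)
    have stop: "inv mk' y ok' 0 k''"
      if "y \<notin> Domain r \<or> y \<in> ?D \<and> mk' ! y \<noteq> 0 \<and> mk' ! y \<noteq> Suc x" "7 + c \<le> k''" for k''
    proof -
      have "mk' ! x \<noteq> 0" using that(1) inv'(3) x(1) Dom by auto
      then show ?thesis
        unfolding inv_def using inv' status_walk_end[OF inv'(6) sv inv'(7) that(1)] that(2) c by auto
    qed
    have II: "I R'' (layout rt mk'' out) k''"
      if "inv mk'' y'' ok'' go'' k''" "regs_ok R'' cnt i j M js" "R'' rE = Word (Suc (i + M))"
        "R'' rX = Word (Suc x)" "R'' rY = Word y''" "R'' rGo = Word go''" "R'' rOk = Word ok''"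
      for R'' k'' mk'' y'' ok'' go''
      unfolding I_def using that by blast
    note exec = rg(2-6) m' inv'(1,2) len big rg(1)[unfolded regs_ok_def] c
    consider (out) "y \<notin> ?D" | (fresh) "y \<in> ?D" "mk' ! y = 0" | (cycle) "y \<in> ?D" "mk' ! y = Suc x"
      | (old) "y \<in> ?D" "mk' ! y \<noteq> 0" "mk' ! y \<noteq> Suc x" by blast
    then show "vc w walk_step I R' m' (k' - 2)"
    proof cases
      case out
      note stop' = stop[OF disjI1, unfolded Dom, OF out]
      show ?thesis
        using out exec
        by (simp add: walk_step_def)
          (intro conjI impI II[OF stop'], simp_all add: regs_ok_def)
    next
      case fresh
      have y: "y + j - i < n" "i \<le> y + j" using fresh len by auto
      let ?mk = "mk'[y := Suc x]" and ?y = "rt ! (y + j - i)"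
      have cont: "inv ?mk ?y ok' 1 k''" if "12 + c \<le> k''" for k''
      proof -
        have step: "(y, ?y) \<in> r" using fresh(1) by (auto simp: r_def hops_def)
        \<comment> \<open>Exactly one position leaves the unstamped set, which pays for this
          step.\<close>
        have "{z \<in> ?D. mk' ! z = 0} = insert y {z \<in> ?D. ?mk ! z = 0}"
          using fresh inv'(1,2) by (auto simp: nth_list_update)
        moreover have "y \<notin> {z \<in> ?D. ?mk ! z = 0}" using inv'(1,2) by simp
        ultimately have "unmarked mk' = Suc (unmarked ?mk)" unfolding unmarked_def by simp
        moreover have "{z \<in> ?D. ?mk ! z \<noteq> 0 \<and> ?mk ! z \<noteq> Suc x} =
            {z \<in> ?D. mk' ! z \<noteq> 0 \<and> mk' ! z \<noteq> Suc x}"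
          using fresh inv'(1,2) by (auto simp: nth_list_update split: if_splits)
        moreover have "(z, ?y) \<in> r\<^sup>+" if "z \<in> ?D" "?mk ! z = Suc x" for z
          using that inv'(1,2,7) step by (cases "z = y") (auto intro: trancl_into_trancl)
        moreover have "?mk ! x \<noteq> 0" using inv'(1-3) by (auto simp: nth_list_update)
        ultimately show ?thesis
          unfolding inv_def using inv' that c y(1) len(5) by (auto simp: nth_list_update)
      qed
      then show ?thesis
        using fresh y exec
        by (simp add: walk_step_def word_sub)
          (intro conjI impI II[OF cont], simp_all add: regs_ok_def)
    next
      case cycle
      have cyc: "inv mk' y 0 0 k''" if "12 + c \<le> k''" for k''
      proof -
        \<comment> \<open>Carrying the current stamp, \<open>y\<close> has a nonempty path to
          itself.\<close>
        have "\<not> acyclic r" using cycle inv'(7) by (auto simp: acyclic_def)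
        moreover have "mk' ! x \<noteq> 0" using inv'(3) cycle by auto
        ultimately show ?thesis
          unfolding inv_def status_def using inv' that c by auto
      qed
      then show ?thesis 
        using cycle exec 
        by (simp add: walk_step_def)
          (intro conjI impI II[OF cyc], simp_all add: regs_ok_def)
    next
      case old
      note stop' = stop[OF disjI2, OF conjI[OF old(1) conjI[OF old(2,3)]]]
      show ?thesis
        using old exec 
        by (simp add: walk_step_def)
          (intro conjI impI II[OF stop'], simp_all add: regs_ok_def)
    qed
  qed
  then show ?thesis unfolding Q_def .
qed

text \<open>Per position, 40 pays for starting and ending a walk and 25 for stamping it, hence the
  factor 65. When the starts are exhausted every position of the interval is stamped, so verdict 1
  certifies the whole domain.\<close>

lemma cycle_code:
  fixes rt i j M
  defines "r \<equiv> hops rt i j M"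
  assumes regs: "regs_ok R cnt i j M js" "R rE = Word (Suc (i + M))" "R rOk = Word 1"
    and len: "length rt = n" "length mk = n" "i + M < n" "j + M < n" "\<forall>y<n. rt ! y < n"
    and mk: "\<forall>z\<in>{i..i + M}. mk ! z = 0"
    and m: "m = layout rt mk out"
    and k: "65 * Suc M + 20 \<le> k"
  shows "vc w cycle_code (\<lambda>R' m' k'. regs_ok R' cnt i j M js \<and>
      R' rOk = Word (if acyclic r then 1 else 0) \<and>
      (\<exists>mk'. m' = layout rt mk' out \<and> length mk' = n) \<and>
      k \<le> k' + (65 * Suc M + 20)) R m k" (is "vc _ _ ?Q _ _ _")
proof -
  let ?D = "{i..i + M}"
  define unmarked where "unmarked mk = card {z \<in> ?D. mk ! z = (0 :: nat)}" for mk
  define Q where "Q = ?Q"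
  define I where "I R' m' k' \<longleftrightarrow> (\<exists>mk' x ok. regs_ok R' cnt i j M js \<and>
      R' rE = Word (Suc (i + M)) \<and> R' rX = Word x \<and> R' rOk = Word ok \<and> m' = layout rt mk' out \<and>
      length mk' = n \<and> i \<le> x \<and> x \<le> Suc (i + M) \<and> (\<forall>z\<in>?D. mk' ! z \<le> x) \<and>
      (\<forall>z\<in>?D. z < x \<longrightarrow> mk' ! z \<noteq> 0) \<and> status ok r {z \<in> ?D. mk' ! z \<noteq> 0} \<and>
      k + 25 * unmarked mk' \<le> k' + 25 * Suc M + 40 * (x - i) + 1)" for R' m' k'
  let ?body = "Basic (Move rY rX) ;; Basic (Op Add rX rX rOne) ;; Basic (Move rGo rOne) ;; walk_code"
  have loop: "vc w (Loop (LessC rX rE) ?body) Q R' m' k'" if "I R' m' k'" for R' m' k'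
    using that
  proof (rule vc_loopI[where I = I])
    fix R' m' k'
    assume "I R' m' k'"
    then obtain mk' x ok where rg: "regs_ok R' cnt i j M js"
      "R' rE = Word (Suc (i + M))" "R' rX = Word x" "R' rOk = Word ok"
      and m': "m' = layout rt mk' out" "length mk' = n"
      and x: "i \<le> x" "x \<le> Suc (i + M)" "\<forall>z\<in>?D. mk' ! z \<le> x" "\<forall>z\<in>?D. z < x \<longrightarrow> mk' ! z \<noteq> 0"
      and st: "status ok r {z \<in> ?D. mk' ! z \<noteq> 0}"
      and k': "k + 25 * unmarked mk' \<le> k' + 25 * Suc M + 40 * (x - i) + 1"
      unfolding I_def by blast
    have xi: "40 * (x - i) \<le> 40 * Suc M" using x by simp
    show "2 \<le> k' \<and> holds (LessC rX rE) R' \<noteq> None" using rg k k' xi by simp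
    {
      assume "holds (LessC rX rE) R' = Some False"
      then have "x = Suc (i + M)" using rg x by simp
      then have "{z \<in> ?D. mk' ! z \<noteq> 0} = Domain r" using x(4) by (auto simp: r_def Domain_hops)
      then have "ok = (if acyclic r then 1 else 0)"
        using st acyclic_if_termi[of r] by (auto simp: status_def)
      then show "Q R' m' (k' - 2)"
        unfolding Q_def using rg m' k' k xi by (intro conjI exI[of _ mk']) simp_all
    }
    assume "holds (LessC rX rE) R' = Some True"
    then have x': "x \<in> ?D" using rg x by simp
    then have "x - i \<le> M" by auto
    then have "25 * unmarked mk' + 48 \<le> k'" using k k' by simp
    then have "48 \<le> k'" and k'': "25 * unmarked mk' + 30 \<le> k' - 5" by linarith+
    then obtain c where c: "k' = 48 + c" using le_Suc_ex by blast
    let ?R = "R'(rY := Word x, rX := Word (Suc x), rGo := Word 1)"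
    have "regs_ok ?R cnt i j M js" using rg(1) by (simp add: regs_ok_def)
    note walk = walk_code[OF this, of x ok rt mk' m' out "k' - 5", folded r_def unmarked_def]
    have "vc w walk_code I ?R m' (k' - 5)"
    proof (rule vc_mono[OF walk], goal_cases)
      case (16 R2 m2 k2)
      then obtain mk2 ok2 where st2: "R2 rOk = Word ok2" "m2 = layout rt mk2 out" "length mk2 = n"
        "mk2 ! x \<noteq> 0" "\<forall>z\<in>?D. mk' ! z \<noteq> 0 \<longrightarrow> mk2 ! z \<noteq> 0" "\<forall>z\<in>?D. mk2 ! z \<le> Suc x"
        "status ok2 r {z \<in> ?D. mk2 ! z \<noteq> 0}"
        "k' - 5 + 25 * unmarked mk2 \<le> k2 + 25 * unmarked mk' + 30"
        by blast
      have "k + 25 * unmarked mk2 \<le> k2 + 25 * Suc M + 40 * (Suc x - i) + 1"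
        using st2(8) k' c x(1) by (simp add: Suc_diff_le)
      moreover have "mk2 ! z \<noteq> 0" if "z \<in> ?D" "z < Suc x" for z
        using that x(4) st2(4,5) by (cases "z = x") auto
      ultimately show ?case
        unfolding I_def using 16 st2 x x'
        by (intro exI[of _ mk2] exI[of _ "Suc x"] exI[of _ ok2]) auto
    qed (use rg m' x' x(3) st len k'' in simp_all)
    then show "vc w ?body I R' m' (k' - 2)"
      using rg c x' len big by (simp add: regs_ok_def)
  qed
  obtain c where c: "k = 85 + c" using k le_Suc_ex[of 85 k] by auto
  have le: "unmarked mk \<le> Suc M" 
  proof -
    have "card {z \<in> ?D. mk ! z = 0} \<le> card ?D" by (rule card_mono) auto
    then show ?thesis by (simp add: unmarked_def)
  qed
  have "I (R(rX := Word i)) m (84 + c)"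
    unfolding I_def
    by (rule exI[of _ mk], rule exI[of _ i], rule exI[of _ 1])
      (use regs len c mk le in \<open>auto simp: m regs_ok_def status_def\<close>)
  from loop[OF this] show ?thesis
    unfolding cycle_code_def Q_def[symmetric] using regs c by (simp add: regs_ok_def)
qed

section \<open>Trial of one candidate and search for the best\<close>

definition roots_ok :: "(nat \<times> nat) set \<Rightarrow> nat list \<Rightarrow> bool" where
  "roots_ok E rt \<longleftrightarrow> length rt = n \<and> (\<forall>y<n. rt ! y < n \<and> (y, rt ! y) \<in> E\<^sup>* \<and> rt ! y \<notin> Domain E)"

text \<open>\<open>acyclic_contraction\<close> applies because the sources of \<open>P\<close> all
  lie below \<open>covered P\<close>, outside the interval, and \<open>j + M < n\<close> keeps the
  targets within the table of roots.\<close>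

lemma extendable_iff_hops:
  assumes P: "is_PBP T P" "acyclic (edges P)" "roots_ok (edges P) rt"
  shows "extendable T P j (Suc M) \<longleftrightarrow> j \<noteq> covered P \<and> covered P + M < n \<and> j + M < n \<and>
    (\<forall>d<Suc M. T ! (covered P + d) = T ! (j + d)) \<and> acyclic (hops rt (covered P) j M)"
proof -
  let ?i = "covered P"
  have "acyclic (edges P \<union> {(?i + d, j + d) | d. d < Suc M}) \<longleftrightarrow> acyclic (hops rt ?i j M)"
    if "j + M < n"
  proof -
    have E: "edges P \<subseteq> {..<?i} \<times> {..<n}" using PBP_edges[OF P(1)] .
    have "{(?i + d, j + d) | d. d < Suc M} = {(x, x + j - ?i) | x. x \<in> {?i..?i + M}}" (is "?A = ?B")
    proof
      show "?B \<subseteq> ?A"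
      proof clarify
        fix x assume "x \<in> {?i..?i + M}"
        then show "\<exists>d. (x, x + j - ?i) = (?i + d, j + d) \<and> d < Suc M"
          by (intro exI[of _ "x - ?i"]) auto
      qed
    qed auto
    moreover have "acyclic (edges P \<union> ?B) \<longleftrightarrow> acyclic (hops rt ?i j M)"
      unfolding hops_def
    proof (rule acyclic_contraction)
      show "finite (edges P)" using E finite_subset by blast
      show "{?i..?i + M} \<inter> Domain (edges P) = {}" using E by auto
      fix x assume "x \<in> {?i..?i + M}"
      then have "x + j - ?i < n" using that by auto
      then show "(x + j - ?i, rt ! (x + j - ?i)) \<in> (edges P)\<^sup>* \<and> rt ! (x + j - ?i) \<notin> Domain (edges P)"
        using P(3) by (simp add: roots_ok_def)
    qed (use P PBP_single_valued in auto)
    ultimately show ?thesis by simp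
  qed
  then show ?thesis unfolding extendable_def by auto
qed

lemma check_code:
  assumes P: "is_PBP T P" "acyclic (edges P)" "roots_ok (edges P) rt" "covered P = i" "i < n"
    and regs: "regs_ok R cnt i j M js"
    and len: "length mk = n" "j < n" "M \<le> n"
    and m: "m = layout rt mk out"
    and k: "81 * M + 140 \<le> k"
  shows "vc w check_code (\<lambda>R' m' k'. regs_ok R' cnt i j M js \<and>
      R' rOk = Word (if extendable T P j (Suc M) then 1 else 0) \<and>
      (\<exists>mk'. m' = layout rt mk' out \<and> length mk' = n) \<and>
      k \<le> k' + (81 * M + 140)) R m k" (is "vc _ _ ?Q _ _ _")
proof -
  define Q where "Q = ?Q"
  have rt: "length rt = n" "\<forall>y<n. rt ! y < n" using P(3) by (auto simp: roots_ok_def)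
  define fits where "fits \<longleftrightarrow> i \<noteq> j \<and> i + M < n \<and> j + M < n"
  define chars where "chars \<longleftrightarrow> (\<forall>d<Suc M. T ! (i + d) = T ! (j + d))"
  have ext: "extendable T P j (Suc M) \<longleftrightarrow> fits \<and> chars \<and> acyclic (hops rt i j M)"
    using extendable_iff_hops[OF P(1-3)] P(4) by (auto simp: fits_def chars_def)
  define Q1 where "Q1 R' m' k' \<longleftrightarrow> regs_ok R' cnt i j M js \<and> R' rE = Word (Suc (i + M)) \<and>
      R' rOk = Word (if fits then 1 else 0) \<and> m' = m \<and> k \<le> k' + 15" for R' m' k'
  \<comment> \<open>Cleared stamps are promised only if the first two stages succeed, since
    otherwise the comparison may not have run at all.\<close>
  define Q2 where "Q2 R' m' k' \<longleftrightarrow> regs_ok R' cnt i j M js \<and> R' rE = Word (Suc (i + M)) \<and>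
      R' rOk = Word (if fits \<and> chars then 1 else 0) \<and>
      (\<exists>mk'. m' = layout rt mk' out \<and> length mk' = n \<and>
        (fits \<and> chars \<longrightarrow> (\<forall>z\<in>{i..i + M}. mk' ! z = 0))) \<and>
      k \<le> k' + 16 * M + 50" for R' m' k'
  show ?thesis
    unfolding check_code_def Q_def[symmetric]
  proof (rule vc_seqI[where Q' = Q1])
    obtain c where c: "k = 140 + c" using k le_Suc_ex[of 140 k] by auto
    then show "vc w (Basic (Move rOk rOne) ;; Basic (Op Add rE rI rM) ;; Basic (Op Add rE rE rOne) ;;
      Cond (EqC rI rJ) (Basic (Move rOk rZero)) Skip ;;
      Cond (LessC rN rE) (Basic (Move rOk rZero)) Skip ;;
      Basic (Op Add rA rJ rM) ;;
      Cond (LessC rA rN) Skip (Basic (Move rOk rZero))) Q1 R m k"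
      using regs P(5) len big by (simp add: regs_ok_def Q1_def fits_def)
  next
    fix R1 m1 k1
    assume "Q1 R1 m1 k1"
    then have q1: "regs_ok R1 cnt i j M js" "R1 rE = Word (Suc (i + M))"
      "R1 rOk = Word (if fits then 1 else 0)" "m1 = layout rt mk out" "k \<le> k1 + 15"
      unfolding Q1_def m by blast+
    obtain c1 where c1: "k1 = 125 + c1" using q1(5) k le_Suc_ex[of 125 k1] by auto
    show "vc w (Cond (EqC rOk rOne) match_code Skip ;; Cond (EqC rOk rOne) cycle_code Skip) Q R1 m1 k1"
    proof (rule vc_seqI[where Q' = Q2])
      show "vc w (Cond (EqC rOk rOne) match_code Skip) Q2 R1 m1 k1"
      proof (cases fits)
        case False
        then show ?thesis using q1 c1 len k by (auto simp: Q2_def regs_ok_def)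
      next
        case True
        have "vc w match_code Q2 R1 m1 (k1 - 2)"
          by (rule vc_mono[OF match_code[OF q1(1,2) _ rt(1) len(1) _ _ q1(4)]])
            (use True q1 k c1 in \<open>auto simp: Q2_def fits_def chars_def\<close>)
        then show ?thesis using True q1 c1 by (simp add: regs_ok_def)
      qed
    next
      fix R2 m2 k2
      assume "Q2 R2 m2 k2"
      then obtain mk2 where q2: "regs_ok R2 cnt i j M js" "R2 rE = Word (Suc (i + M))"
        "R2 rOk = Word (if fits \<and> chars then 1 else 0)" "m2 = layout rt mk2 out" "length mk2 = n"
        "fits \<and> chars \<longrightarrow> (\<forall>z\<in>{i..i + M}. mk2 ! z = 0)" "k \<le> k2 + 16 * M + 50"
        unfolding Q2_def by blast
      have k2: "65 * Suc M + 20 \<le> k2 - 2" "90 \<le> k2" using q2(7) k by simp_all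
      then obtain c2 where c2: "k2 = 90 + c2" using le_Suc_ex by blast
      show "vc w (Cond (EqC rOk rOne) cycle_code Skip) Q R2 m2 k2"
      proof (cases "fits \<and> chars")
        case False
        then have "Q R2 m2 (k2 - 2)" unfolding Q_def using ext q2 k by auto
        then show ?thesis using False q2 c2 by (auto simp: regs_ok_def)
      next
        case True
        then have z: "\<forall>z\<in>{i..i + M}. mk2 ! z = 0" using q2(6) by blast
        have "vc w cycle_code Q R2 m2 (k2 - 2)"
          by (rule vc_mono[OF cycle_code[OF q2(1,2) _ rt(1) q2(5) _ _ rt(2) z q2(4) k2(1)]])
            (use True q2 k c2 ext in \<open>auto simp: Q_def fits_def\<close>)
        then show ?thesis using True q2 c2 by (simp add: regs_ok_def)
      qed
    qed
  qed
qed

text \<open>Every trial raises \<open>j + M\<close> by exactly one, while \<open>j\<close> stays at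
  most n and \<open>M\<close> at most \<open>maxLF T P\<close>; this bounds the number of
  trials.\<close>

lemma search_code:
  assumes P: "is_PBP T P" "acyclic (edges P)" "roots_ok (edges P) rt" "covered P = i" "i < n"
    and regs: "regs_ok R cnt i j M js"
    and len: "length mk = n"
    and m: "m = layout rt mk out"
    and k: "(81 * maxLF T P + 160) * (n + maxLF T P) + 10 \<le> k"
  shows "vc w search_code (\<lambda>R' m' k'. \<exists>mk' js'. regs_ok R' cnt i n (maxLF T P) js' \<and>
      m' = layout rt mk' out \<and> length mk' = n \<and> is_LP T P
        (if maxLF T P = 0 then CharP (T ! i) else TargetP (Suc js') (maxLF T P)) \<and>
      (maxLF T P > 0 \<longrightarrow> extendable T P js' (maxLF T P)) \<and>
      k \<le> k' + (81 * maxLF T P + 160) * (n + maxLF T P) + 10) R m k" (is "vc _ _ ?Q _ _ _")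
proof -
  define Q where "Q = ?Q"
  define L where "L = maxLF T P"
  define K where "K = 81 * L + 160"
  \<comment> \<open>\<open>p\<close> counts the trials that remain to be paid for; \<open>K\<close>
    covers the dearest one, with \<open>M' = L\<close>.\<close>
  define I where "I R' m' k' \<longleftrightarrow> (\<exists>mk' j' M' js' p. regs_ok R' cnt i j' M' js' \<and>
      m' = layout rt mk' out \<and> length mk' = n \<and> j' \<le> n \<and> M' \<le> L \<and> p + j' + M' = n + L \<and>
      (M' > 0 \<longrightarrow> extendable T P js' M') \<and> (\<forall>j''<j'. \<not> extendable T P j'' (Suc M')) \<and>
      k + K * p \<le> k' + K * (n + L) + 2)" for R' m' k'
  have loop: "vc w (Loop (LessC rJ rN) search_step) Q R' m' k'" if "I R' m' k'" for R' m' k'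
    using that
  proof (rule vc_loopI[where I = I])
    fix R' m' k'
    assume "I R' m' k'"
    then obtain mk' j' M' js' p where rg: "regs_ok R' cnt i j' M' js'"
      and m': "m' = layout rt mk' out" "length mk' = n"
      and b: "j' \<le> n" "M' \<le> L" "p + j' + M' = n + L"
      and e: "M' > 0 \<longrightarrow> extendable T P js' M'" "\<forall>j''<j'. \<not> extendable T P j'' (Suc M')"
      and k': "k + K * p \<le> k' + K * (n + L) + 2"
      unfolding I_def by blast
    have k0: "K * (n + L) + 10 \<le> k" using k by (simp add: K_def L_def)
    show "2 \<le> k' \<and> holds (LessC rJ rN) R' \<noteq> None"
      using rg k' k0 by (simp add: regs_ok_def)
    {
      assume "holds (LessC rJ rN) R' = Some False"
      then have j': "j' = n" using rg b by (simp add: regs_ok_def)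
      have cov: "covered P < n" using P(4,5) by simp
      have none: "\<not> extendable T P j'' (Suc M')" if "j'' < n" for j'' using e(2) j' that by blast
      note max = maxLF_eqI[OF P(1) cov e(1) none]
      have "is_LP T P (if M' = 0 then CharP (T ! i) else TargetP (Suc js') M')"
        using max e(1) P(4) by (auto simp: is_LP_def char_at_def extendable_def Suc_le_eq)
      then show "Q R' m' (k' - 2)"
        unfolding Q_def max(1)
        by (intro exI[of _ mk'] exI[of _ js'])
          (use rg m' e(1) k' k0 j' max(1) in \<open>auto simp: K_def L_def\<close>)
    }
    assume "holds (LessC rJ rN) R' = Some True"
    then have j': "j' < n" using rg b by (simp add: regs_ok_def)
    then obtain p' where p: "p = Suc p'" using b by (cases p) auto
    have M'n: "M' \<le> n" using e(1) by (cases "M' = 0") (auto simp: extendable_def)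
    have kk: "K * p' + K + 8 \<le> k'" using k' k0 p by simp
    have KM: "81 * M' + 160 \<le> K" using b by (simp add: K_def)
    then have kc: "81 * M' + 140 \<le> k' - 2" using kk by linarith
    show "vc w search_step I R' m' (k' - 2)"
      unfolding search_step_def
    proof (rule vc_seqI[OF check_code[OF P rg m'(2) j' M'n m'(1) kc]], elim conjE exE)
      fix R2 m2 k2 mk2
      assume r2: "regs_ok R2 cnt i j' M' js'"
        "R2 rOk = Word (if extendable T P j' (Suc M') then 1 else 0)"
        "m2 = layout rt mk2 out" "length mk2 = n" "k' - 2 \<le> k2 + (81 * M' + 140)"
      have "18 \<le> k2" using r2(5) kk KM by linarith
      then obtain c where c: "k2 = 18 + c" using le_Suc_ex by blast
      have II: "I R3 m2 k3" if "regs_ok R3 cnt i ja Ma jsa" "ja \<le> n" "Ma \<le> L" "p' + ja + Ma = n + L"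
        "Ma > 0 \<longrightarrow> extendable T P jsa Ma" "\<forall>j''<ja. \<not> extendable T P j'' (Suc Ma)" "c + 4 \<le> k3"
        for R3 ja Ma jsa k3
      proof -
        have "k + K * p' \<le> k3 + K * (n + L) + 2"
          using k' r2(5) c KM that(7) p by simp
        then show ?thesis unfolding I_def using r2(3,4) that by blast
      qed
      show "vc w (Cond (EqC rOk rOne) (Basic (Op Add rM rM rOne) ;; Basic (Move rJs rJ))
          (Basic (Op Add rJ rJ rOne))) I R2 m2 k2"
      proof (cases "extendable T P j' (Suc M')")
        case True
        have "Suc M' \<le> L"
          unfolding L_def using extendable_le_maxLF[OF P(1) _ True] P(4,5) by simp
        \<comment> \<open>Candidates discarded earlier stay discarded: they already failed at a
          smaller length.\<close>
        moreover have "\<not> extendable T P j'' (Suc (Suc M'))" if "j'' < j'" for j''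
          using e(2) that extendable_mono[of T P j'' "Suc (Suc M')" "Suc M'"] by auto
        ultimately have "I (R2(rM := Word (Suc M'), rJs := Word j')) m2 (14 + c)"
          using r2(1) True b p
          by (intro II[where ja = j' and Ma = "Suc M'" and jsa = j']) (auto simp: regs_ok_def)
        then show ?thesis using True r2 c M'n big by (simp add: regs_ok_def)
      next
        case False
        have "I (R2(rJ := Word (Suc j'))) m2 (15 + c)"
          using r2(1) False b p j' e
          by (intro II[where ja = "Suc j'" and Ma = M' and jsa = js'])
            (auto simp: regs_ok_def less_Suc_eq)
        then show ?thesis using False r2 c j' big by (simp add: regs_ok_def)
      qed
    qed
  qed
  obtain c where c: "k = 10 + c" using k le_Suc_ex[of 10 k] by auto
  have "I (R(rM := Word 0, rJ := Word 0)) m (8 + c)"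
    unfolding I_def
    by (rule exI[of _ mk], rule exI[of _ 0], rule exI[of _ 0], rule exI[of _ js],
        rule exI[of _ "n + L"])
      (use regs len c in \<open>simp add: m regs_ok_def\<close>)
  from loop[OF this] show ?thesis
    unfolding search_code_def Q_def[symmetric] using regs c by (simp add: regs_ok_def)
qed

section \<open>Updating the roots\<close>

text \<open>A hop follows the new edge of a position in the interval and then jumps to the stored
  entry of its target. Entries need only be reachable in \<open>F\<close> and lie outside
  \<open>Domain E\<close>, so they may be old roots or already updated ones.\<close>

lemma climb_loop:
  fixes E :: "(nat \<times> nat) set" and i js M :: nat
  defines "F \<equiv> E \<union> {(i + d, js + d) | d. d < M}"
  assumes acyc: "acyclic F"
    and rt: "length rt = n" "\<forall>y<n. rt ! y < n \<and> (y, rt ! y) \<in> F\<^sup>* \<and> rt ! y \<notin> Domain E"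
    and regs: "regs_ok R cnt i j M js" "R rE = Word (i + M)" "R rX = Word x" "R rY = Word y"
      "R rGo = Word 1"
    and len: "i + M \<le> n" "js + M \<le> n" "y < n"
    and y: "(x, y) \<in> F\<^sup>*" "y \<notin> Domain E"
    and m: "m = layout rt mk out" "length mk = n"
    and k: "20 * M + 30 \<le> k"
  shows "vc w (Loop (EqC rGo rOne) climb_step) (\<lambda>R' m' k'. regs_ok R' cnt i j M js \<and>
      R' rE = Word (i + M) \<and> R' rX = Word x \<and> m' = m \<and>
      (\<exists>z<n. R' rY = Word z \<and> (x, z) \<in> F\<^sup>* \<and> z \<notin> Domain F) \<and> k \<le> k' + (20 * M + 30)) R m k"
    (is "vc _ _ ?Q _ _ _")
proof -
  let ?D = "{i..<i + M}"
  define Q where "Q = ?Q"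
  \<comment> \<open>The number of interval positions reachable from \<open>z\<close>: acyclicity
    makes it drop at every hop, and it is at most \<open>M\<close>.\<close>
  define rk where "rk z = card {u \<in> ?D. (z, u) \<in> F\<^sup>*}" for z
  have Dom: "Domain F = Domain E \<union> ?D"
  proof -
    have "\<exists>d. z = i + d \<and> d < M" if "z \<in> ?D" for z
      using that by (intro exI[of _ "z - i"]) auto
    then have "?D \<subseteq> Domain {(i + d, js + d) | d. d < M}" by blast
    moreover have "Domain {(i + d, js + d) | d. d < M} \<subseteq> ?D" by auto
    ultimately show ?thesis unfolding F_def Domain_Un_eq by blast
  qed
  define I where "I R' m' k' \<longleftrightarrow> (\<exists>z go. regs_ok R' cnt i j M js \<and>
      R' rE = Word (i + M) \<and> R' rX = Word x \<and> R' rY = Word z \<and> R' rGo = Word go \<and> m' = m \<and>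
      z < n \<and> (x, z) \<in> F\<^sup>* \<and> z \<notin> Domain E \<and>
      (go = 1 \<and> k + 20 * rk z \<le> k' + 20 * M \<or>
       go = 0 \<and> z \<notin> ?D \<and> k \<le> k' + 20 * M + 20))" for R' m' k'
  have "vc w (Loop (EqC rGo rOne) climb_step) Q R m k"
  proof (rule vc_loopI[where I = I])
    have "rk y \<le> card ?D" unfolding rk_def by (rule card_mono) auto
    then show "I R m k"
      unfolding I_def by (intro exI[of _ y] exI[of _ 1]) (use regs m len y in auto)
  next
    fix R' m' k'
    assume "I R' m' k'"
    then obtain z go where rg: "regs_ok R' cnt i j M js" "R' rE = Word (i + M)" "R' rX = Word x"
      "R' rY = Word z" "R' rGo = Word go" and m': "m' = m"
      and z: "z < n" "(x, z) \<in> F\<^sup>*" "z \<notin> Domain E"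
      and go: "go = 1 \<and> k + 20 * rk z \<le> k' + 20 * M \<or> go = 0 \<and> z \<notin> ?D \<and> k \<le> k' + 20 * M + 20"
      unfolding I_def by blast
    have one: "R' rOne = Word 1" using rg(1) by (simp add: regs_ok_def)
    show "2 \<le> k' \<and> holds (EqC rGo rOne) R' \<noteq> None" using go k rg(5) one by auto
    {
      assume "holds (EqC rGo rOne) R' = Some False"
      then have "go \<noteq> 1" using rg one by simp
      then show "Q R' m' (k' - 2)"
        unfolding Q_def using rg m' z go Dom k by (intro conjI exI[of _ z]) auto
    }
    assume "holds (EqC rGo rOne) R' = Some True"
    then have go': "k + 20 * rk z \<le> k' + 20 * M" using rg one go by auto
    then have "30 \<le> k'" using k by simp
    then obtain c where c: "k' = 30 + c" using le_Suc_ex by blast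
    have II: "I R'' m'' k''" if "regs_ok R'' cnt i j M js"
      "R'' rE = Word (i + M)" "R'' rX = Word x" "R'' rY = Word za" "R'' rGo = Word ga" "m'' = m"
      "za < n \<and> (x, za) \<in> F\<^sup>* \<and> za \<notin> Domain E \<and>
        (ga = 1 \<and> k + 20 * rk za \<le> k'' + 20 * M \<or> ga = 0 \<and> za \<notin> ?D \<and> k \<le> k'' + 20 * M + 20)"
      for R'' m'' k'' za ga
      unfolding I_def using that by blast
    note exec = rg(2-5) m' m rt(1) z(1) len big rg(1)[unfolded regs_ok_def] c
    show "vc w climb_step I R' m' (k' - 2)"
    proof (cases "z \<in> ?D")
      case False
      have "I (R'(rGo := Word 0)) m' (23 + c)" "I (R'(rGo := Word 0)) m' (25 + c)"
        by (rule II[of _ z 0]; use rg m' z False go' c in \<open>simp add: regs_ok_def\<close>)+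
      then show ?thesis using False exec by (auto simp: climb_step_def)
    next
      case True
      let ?u = "z + js - i"
      have u: "?u < n" "i \<le> z + js" using True len by auto
      have "(z, ?u) = (i + (z - i), js + (z - i))" "z - i < M" using True by auto
      then have "(z, ?u) \<in> F" unfolding F_def by blast
      moreover have "(?u, rt ! ?u) \<in> F\<^sup>*" using rt u by blast
      ultimately have hop: "(z, rt ! ?u) \<in> F\<^sup>+" by (rule rtrancl_into_trancl2)
      have "rk (rt ! ?u) < rk z"
        unfolding rk_def
      proof (rule psubset_card_mono)
        have "(rt ! ?u, z) \<notin> F\<^sup>*"
          using hop acyc by (auto simp: acyclic_def dest: trancl_rtrancl_trancl)
        moreover have "(z, v) \<in> F\<^sup>*" if "(rt ! ?u, v) \<in> F\<^sup>*" for v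
          using hop that by (meson trancl_into_rtrancl rtrancl_trans)
        ultimately show "{v \<in> ?D. (rt ! ?u, v) \<in> F\<^sup>*} \<subset> {v \<in> ?D. (z, v) \<in> F\<^sup>*}"
          using True by blast
      qed simp
      then have "k + 20 * rk (rt ! ?u) \<le> 18 + c + 20 * M" using go' c by linarith
      moreover have "(x, rt ! ?u) \<in> F\<^sup>*" using z(2) hop by (meson trancl_into_rtrancl rtrancl_trans)
      ultimately have "I (R'(rGo := Word 1, rA := Word (n + ?u), rY := Word (rt ! ?u))) m' (18 + c)"
        using rg rt u by (intro II[of _ "rt ! ?u" 1]) (auto simp: regs_ok_def m')
      then show ?thesis using True u exec
        by (simp add: climb_step_def word_sub fun_upd_twist)
    qed
  qed
  then show ?thesis unfolding Q_def .
qed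

text \<open>The table is overwritten in place: a root of \<open>F\<close> lies outside
  \<open>Domain E\<close> as well, so updated entries still meet the demands of
  \<open>climb_loop\<close>.\<close>

lemma update_code:
  fixes E :: "(nat \<times> nat) set" and i js M :: nat
  defines "F \<equiv> E \<union> {(i + d, js + d) | d. d < M}"
  assumes acyc: "acyclic F" and rt: "roots_ok E rt"
    and regs: "regs_ok R cnt i j M js"
    and len: "i + M \<le> n" "js + M \<le> n"
    and m: "m = layout rt mk out" "length mk = n"
    and k: "n * (20 * M + 50) + 20 \<le> k"
  shows "vc w update_code (\<lambda>R' m' k'. regs_ok R' cnt i j M js \<and>
      (\<exists>rt'. roots_ok F rt' \<and> m' = layout rt' mk out) \<and> k \<le> k' + n * (20 * M + 50) + 20) R m k"
    (is "vc _ _ ?Q _ _ _")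
proof -
  define Q where "Q = ?Q"
  define K where "K = 20 * M + 50"
  define good where "good rt' x \<longleftrightarrow> length rt' = n \<and> (\<forall>y<n. rt' ! y < n \<and> (y, rt' ! y) \<in> F\<^sup>* \<and>
      rt' ! y \<notin> Domain E \<and> (y < x \<longrightarrow> rt' ! y \<notin> Domain F))" for rt' and x :: nat
  define I where "I R' m' k' \<longleftrightarrow> (\<exists>x p rt'. regs_ok R' cnt i j M js \<and> R' rE = Word (i + M) \<and>
      R' rX = Word x \<and> m' = layout rt' mk out \<and> good rt' x \<and> x + p = n \<and>
      k + K * p \<le> k' + K * n + 2)" for R' m' k'
  have k0: "K * n + 20 \<le> k" using k by (simp add: K_def mult.commute)
  have loop: "vc w (Loop (LessC rX rN) update_step) Q R' m' k'" if "I R' m' k'" for R' m' k'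
    using that
  proof (rule vc_loopI[where I = I])
    fix R' m' k'
    assume "I R' m' k'"
    then obtain x p rt' where rg: "regs_ok R' cnt i j M js" "R' rE = Word (i + M)" "R' rX = Word x"
      and m': "m' = layout rt' mk out" and good: "good rt' x"
      and x: "x + p = n" and k': "k + K * p \<le> k' + K * n + 2"
      unfolding I_def by blast
    show "2 \<le> k' \<and> holds (LessC rX rN) R' \<noteq> None" using rg k' k0 by (simp add: regs_ok_def)
    {
      assume "holds (LessC rX rN) R' = Some False"
      then have "x = n" using rg x by (simp add: regs_ok_def)
      then have "roots_ok F rt'" using good by (simp add: good_def roots_ok_def)
      then show "Q R' m' (k' - 2)"
        unfolding Q_def using rg m' k' k0
        by (intro conjI exI[of _ rt']) (simp_all add: K_def mult.commute)
    }
    assume "holds (LessC rX rN) R' = Some True"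
    then have xn: "x < n" using rg x by (simp add: regs_ok_def)
    then obtain p' where p: "p = Suc p'" using x by (cases p) auto
    have "K + 18 \<le> k'" using k' k0 p by simp
    then have kc: "20 * M + 30 \<le> k' - 5" "18 \<le> k'" by (simp_all add: K_def)
    then obtain c where c: "k' = 18 + c" using le_Suc_ex by blast
    have g: "length rt' = n" "\<forall>y<n. rt' ! y < n \<and> (y, rt' ! y) \<in> F\<^sup>* \<and> rt' ! y \<notin> Domain E"
      "rt' ! x < n" "(x, rt' ! x) \<in> F\<^sup>*" "rt' ! x \<notin> Domain E"
      using good xn by (auto simp: good_def)
    let ?R = "R'(rA := Word (n + x), rY := Word (rt' ! x), rGo := Word 1)"
    show "vc w update_step I R' m' (k' - 2)"
      unfolding update_step_def
    proof (rule vc_seqI[where Q' = "\<lambda>R2 m2 k2. R2 = ?R \<and> m2 = m' \<and> k2 = k' - 5"])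
      show "vc w (Basic (Op Add rA rN rX) ;; Basic (Load rY rA) ;; Basic (Move rGo rOne))
          (\<lambda>R2 m2 k2. R2 = ?R \<and> m2 = m' \<and> k2 = k' - 5) R' m' (k' - 2)"
        using rg xn c g m' big by (simp add: regs_ok_def)
    next
      fix R2 m2 k2
      assume "R2 = ?R \<and> m2 = m' \<and> k2 = k' - 5"
      then have eq: "R2 = ?R" "m2 = m'" "k2 = k' - 5" by auto
      have rg2: "regs_ok ?R cnt i j M js" "?R rE = Word (i + M)" "?R rX = Word x"
        "?R rY = Word (rt' ! x)" "?R rGo = Word 1"
        using rg by (simp_all add: regs_ok_def)
      note climb = climb_loop[OF acyc[unfolded F_def] g(1) g(2)[unfolded F_def] rg2 len g(3)
          g(4)[unfolded F_def] g(5) m' m(2) kc(1), folded F_def]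
      show "vc w (Loop (EqC rGo rOne) climb_step ;;
          Basic (Op Add rA rN rX) ;; Basic (Store rA rY) ;; Basic (Op Add rX rX rOne)) I R2 m2 k2"
        unfolding eq
      proof (rule vc_seqI[OF climb], elim conjE exE)
        fix R3 m3 k3 z
        assume r3: "regs_ok R3 cnt i j M js" "R3 rE = Word (i + M)" "R3 rX = Word x" "m3 = m'"
          "z < n" "R3 rY = Word z" "(x, z) \<in> F\<^sup>*" "z \<notin> Domain F" "k' - 5 \<le> k3 + (20 * M + 30)"
        have "30 \<le> k3" using r3(9) \<open>K + 18 \<le> k'\<close> by (simp add: K_def)
        then obtain c3 where c3: "k3 = 30 + c3" using le_Suc_ex by blast
        have "good (rt'[x := z]) (Suc x)"
          using good xn r3(5,7,8) unfolding good_def F_def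
          by (auto simp: nth_list_update less_Suc_eq)
        moreover have "k + K * p' \<le> 27 + c3 + K * n + 2"
          using k' p r3(9) c3 c by (simp add: K_def)
        ultimately have "I (R3(rA := Word (n + x), rX := Word (Suc x))) (layout (rt'[x := z]) mk out) (27 + c3)"
          unfolding I_def using r3 x p
          by (intro exI[of _ "Suc x"] exI[of _ p'] exI[of _ "rt'[x := z]"]) (auto simp: regs_ok_def)
        then show "vc w (Basic (Op Add rA rN rX) ;; Basic (Store rA rY) ;; Basic (Op Add rX rX rOne)) I R3 m3 k3"
          using r3 m' g(1) xn c3 big by (simp add: regs_ok_def)
      qed
    qed
  qed
  obtain c where c: "k = 20 + c" using k le_Suc_ex[of 20 k] by auto
  have "good rt 0"
    using rt rtrancl_mono[of E F] by (auto simp: good_def roots_ok_def F_def)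
  then have "I (R(rE := Word (i + M), rX := Word 0)) m (18 + c)"
    unfolding I_def using regs c m
    by (intro exI[of _ 0] exI[of _ n] exI[of _ rt]) (auto simp: regs_ok_def)
  from loop[OF this] show ?thesis
    unfolding update_code_def Q_def[symmetric] using regs c len big by (simp add: regs_ok_def)
qed

section \<open>One phrase and the whole parse\<close>

text \<open>Each phrase covers at least one position, so \<open>length P \<le> covered P\<close>
  keeps the output within its 2n cells. \<open>j\<close>, \<open>M\<close> and \<open>js\<close> are
  whatever the previous search left behind.\<close>

definition parsed :: "'a phrase list \<Rightarrow> (nat \<Rightarrow> 'a cell) \<Rightarrow> 'a cell list \<Rightarrow> bool" where
  "parsed P R m \<longleftrightarrow> LZRR_prefix T P \<and> is_PBP T P \<and> acyclic (edges P) \<and> length P \<le> covered P \<and>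
     (\<exists>rt mk out j M js. regs_ok R (length P) (covered P) j M js \<and> roots_ok (edges P) rt \<and>
       m = layout rt mk out \<and> length mk = n \<and> length out = 2 * n \<and>
       take (2 * length P) out = concat (map encode_phrase P))"

text \<open>The bound adds the search, one climb per position, and the output. A character phrase
  has length 1 although \<open>L = 0\<close>, hence \<open>max 1 L\<close>.\<close>

lemma phrase_code:
  fixes P :: "'a phrase list"
  defines "L \<equiv> maxLF T P"
  assumes P: "parsed P R m" "covered P < n"
    and k: "(81 * L + 160) * (n + L) + n * (20 * L + 50) + 80 \<le> k"
  shows "vc w (search_code ;; emit_code) (\<lambda>R' m' k'. \<exists>f. plen f = max 1 L \<and> parsed (P @ [f]) R' m' \<and>
      k \<le> k' + ((81 * L + 160) * (n + L) + n * (20 * L + 50) + 80)) R m k" (is "vc _ _ ?Q _ _ _")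
proof -
  define Q where "Q = ?Q"
  define i cnt where "i = covered P" and "cnt = length P"
  define K where "K = (81 * L + 160) * (n + L)"
  define K' where "K' = n * (20 * L + 50)"
  obtain rt mk out j M js where st: "LZRR_prefix T P" "is_PBP T P" "acyclic (edges P)"
    "cnt \<le> i" "regs_ok R cnt i j M js" "roots_ok (edges P) rt" "m = layout rt mk out"
    "length mk = n" "length out = 2 * n" "take (2 * cnt) out = concat (map encode_phrase P)"
    using P(1) unfolding parsed_def i_def cnt_def by blast
  have i: "covered P = i" "i < n" using P(2) by (simp_all add: i_def)
  have kk: "K + K' + 80 \<le> k" using k by (simp add: K_def K'_def)
  then have ks: "(81 * maxLF T P + 160) * (n + maxLF T P) + 10 \<le> k" by (simp add: K_def L_def)
  note search = search_code[OF st(2,3,6) i st(5,8,7) ks, folded L_def, folded K_def]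
  have "vc w (search_code ;; emit_code) Q R m k"
  proof (rule vc_seqI[OF search], elim exE conjE)
    fix R1 m1 k1 mk1 js1
    assume s1: "regs_ok R1 cnt i n L js1" "m1 = layout rt mk1 out" "length mk1 = n"
      "is_LP T P (if L = 0 then CharP (T ! i) else TargetP (Suc js1) L)"
      "L > 0 \<longrightarrow> extendable T P js1 L" "k \<le> k1 + K + 10"
    have "K' + 70 \<le> k1" using s1(6) kk by linarith
    then obtain c where c: "k1 = 70 + (K' + c)"
      using le_Suc_ex[of "K' + 70" k1] by auto
    have lrt: "length rt = n" using st(6) by (simp add: roots_ok_def)
    have QI: "Q R2 (layout rt2 mk1 (out[2 * cnt := a, Suc (2 * cnt) := b])) k2"
      if "f = (if L = 0 then CharP (T ! i) else TargetP (Suc js1) L)" "encode_phrase f = [a, b]"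
        "is_PBP T (P @ [f])" "acyclic (edges (P @ [f]))" "roots_ok (edges (P @ [f])) rt2"
        "regs_ok R2 (Suc cnt) (i + plen f) n L js1" "c \<le> k2"
      for f a b rt2 R2 k2
    proof -
      have pl: "plen f = max 1 L" unfolding that(1) by auto
      have "LZRR_prefix T (P @ [f])" unfolding that(1) by (rule LZRR_prefix.extend[OF st(1) P(2) s1(4)])
      moreover have "take (2 * length (P @ [f])) (out[2 * cnt := a, Suc (2 * cnt) := b]) =
          concat (map encode_phrase (P @ [f]))"
        using take_two_updates[of "2 * cnt" out a b] st(4,9,10) i(2) that(2) by (simp add: cnt_def)
      moreover have "length (P @ [f]) \<le> covered (P @ [f])"
        using st(4) pl by (simp add: i_def cnt_def)
      moreover have "regs_ok R2 (length (P @ [f])) (covered (P @ [f])) n L js1"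
        using that(6) by (simp add: i_def cnt_def)
      ultimately have "parsed (P @ [f]) R2 (layout rt2 mk1 (out[2 * cnt := a, Suc (2 * cnt) := b]))"
        unfolding parsed_def using that(3-5) s1(3) st(9)
        by (intro conjI exI[of _ rt2] exI[of _ mk1] exI[of _ "out[2 * cnt := a, Suc (2 * cnt) := b]"]
            exI[of _ n] exI[of _ L] exI[of _ js1]) simp_all
      then show ?thesis
        unfolding Q_def using pl s1(6) c that(7) by (intro exI[of _ f]) (simp add: K_def K'_def)
    qed
    show "vc w emit_code Q R1 m1 k1"
    proof (cases "L = 0")
      case True
      have ok: "is_PBP T (P @ [CharP (T ! i)])" using st(2) i by (simp add: char_at_def)
      have "Q (R1(rOut := Word (3 * n + 2 * Suc cnt), rA := Sym (T ! i), rI := Word (Suc i),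
          rCnt := Word (Suc cnt)))
          (layout rt mk1 (out[2 * cnt := Word 0, Suc (2 * cnt) := Sym (T ! i)])) (61 + (K' + c))"
        by (rule QI[where f = "CharP (T ! i)"])
          (use True st s1 ok in \<open>auto simp: regs_ok_def\<close>)
      then show ?thesis
        unfolding emit_code_def using True s1(1-3) st(4,9) i lrt c big
        by (simp add: regs_ok_def fun_upd_twist)
    next
      case False
      then have ext: "extendable T P js1 L" using s1(5) by simp
      then have b: "i + L \<le> n" "js1 + L \<le> n" and acyc: "acyclic (edges P \<union> {(i + d, js1 + d) | d. d < L})"
        by (auto simp: extendable_def i_def)
      have js1: "js1 < n" using b False by simp
      have "valid_PBP T (P @ [TargetP (Suc js1) L])" using extendable_iff[OF st(2) P(2) js1] ext by simp
      then have val: "is_PBP T (P @ [TargetP (Suc js1) L])" by (simp add: valid_PBP_iff del: is_PBP_snoc)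
      have ku: "n * (20 * L + 50) + 20 \<le> k1 - 2" using c by (simp add: K'_def)
      note update = update_code[OF acyc st(6) s1(1) b s1(2,3) ku, folded K'_def]
      have "vc w (update_code ;;
        Basic (Store rOut rM) ;; Basic (Op Add rOut rOut rOne) ;;
        Basic (Op Add rA rJs rOne) ;; Basic (Store rOut rA) ;;
        Basic (Op Add rI rI rM) ;;
        Basic (Op Add rOut rOut rOne) ;; Basic (Op Add rCnt rCnt rOne)) Q R1 m1 (k1 - 2)"
      proof (rule vc_seqI[OF update], elim exE conjE)
        fix R2 m2 k2 rt2
        assume s2: "regs_ok R2 cnt i n L js1"
          "roots_ok (edges P \<union> {(i + d, js1 + d) | d. d < L}) rt2" "m2 = layout rt2 mk1 out"
          "k1 - 2 \<le> k2 + K' + 20"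
        have "48 + c \<le> k2" using s2(4) c by simp
        then obtain c2 where c2: "k2 = 48 + (c + c2)" using le_Suc_ex[of "48 + c" k2] by auto
        have lrt2: "length rt2 = n" using s2(2) by (simp add: roots_ok_def)
        have "Q (R2(rOut := Word (3 * n + 2 * Suc cnt), rA := Word (Suc js1), rI := Word (i + L),
            rCnt := Word (Suc cnt)))
            (layout rt2 mk1 (out[2 * cnt := Word L, Suc (2 * cnt) := Word (Suc js1)])) (41 + (c + c2))"
          by (rule QI[where f = "TargetP (Suc js1) L"])
            (use False s2 val acyc in \<open>auto simp: regs_ok_def i_def simp del: is_PBP_snoc\<close>)
        then show "vc w (Basic (Store rOut rM) ;; Basic (Op Add rOut rOut rOne) ;;
            Basic (Op Add rA rJs rOne) ;; Basic (Store rOut rA) ;;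
            Basic (Op Add rI rI rM) ;;
            Basic (Op Add rOut rOut rOne) ;; Basic (Op Add rCnt rCnt rOne)) Q R2 m2 k2"
          using s2(1,3) s1(3) st(4,9) i lrt2 c2 b js1 big
          by (simp add: regs_ok_def fun_upd_twist)
      qed
      then show ?thesis
        unfolding emit_code_def using False s1(1) c by (simp add: regs_ok_def del: vc.simps(3))
    qed
  qed
  then show ?thesis unfolding Q_def .
qed

lemma init_code:
  assumes k: "10 * n + 20 \<le> k"
  shows "vc w init_code (\<lambda>R' m' k'. parsed [] R' m' \<and> k \<le> k' + 10 * n + 20)
    ((\<lambda>_. Word 0)(0 := Word n)) (map Sym T @ replicate (4 * n) (Word 0)) k" (is "vc _ _ ?Q _ _ _")
proof -
  define Q where "Q = ?Q"
  define I where "I R' m' k' \<longleftrightarrow> (\<exists>x rt. regs_ok R' 0 0 0 0 0 \<and> R' rX = Word x \<and> x \<le> n \<and>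
      m' = layout rt (replicate n 0) (replicate (2 * n) (Word 0)) \<and> length rt = n \<and>
      (\<forall>y<x. rt ! y = y) \<and> k \<le> k' + 10 * x + 3)" for R' m' k'
  let ?body = "Basic (Op Add rA rN rX) ;; Basic (Store rA rX) ;; Basic (Op Add rX rX rOne)"
  have loop: "vc w (Loop (LessC rX rN) ?body) Q R' m' k'" if "I R' m' k'" for R' m' k'
    using that
  proof (rule vc_loopI[where I = I])
    fix R' m' k'
    assume "I R' m' k'"
    then obtain x rt where rg: "regs_ok R' 0 0 0 0 0" "R' rX = Word x" and x: "x \<le> n"
      and m': "m' = layout rt (replicate n 0) (replicate (2 * n) (Word 0))" "length rt = n"
      and rt: "\<forall>y<x. rt ! y = y" and k': "k \<le> k' + 10 * x + 3"
      unfolding I_def by blast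
    show "2 \<le> k' \<and> holds (LessC rX rN) R' \<noteq> None" using rg k' k x by (simp add: regs_ok_def)
    {
      assume "holds (LessC rX rN) R' = Some False"
      then have "x = n" using rg x by (simp add: regs_ok_def)
      then have "roots_ok {} rt" using rt m'(2) by (simp add: roots_ok_def)
      then have "parsed [] R' m'"
        unfolding parsed_def using rg m'
        by (intro conjI exI[of _ rt] exI[of _ "replicate n 0"] exI[of _ "replicate (2 * n) (Word 0)"]
            exI[of _ 0]) (simp_all add: LZRR_prefix.empty acyclic_def)
      then show "Q R' m' (k' - 2)" unfolding Q_def using k' k \<open>x = n\<close> by simp
    }
    assume "holds (LessC rX rN) R' = Some True"
    then have xn: "x < n" using rg x by (simp add: regs_ok_def)
    then have "10 \<le> k'" using k k' by simp
    then obtain c where c: "k' = 10 + c" using le_Suc_ex by blast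
    have "I (R'(rA := Word (n + x), rX := Word (Suc x)))
        (layout (rt[x := x]) (replicate n 0) (replicate (2 * n) (Word 0))) (5 + c)"
      unfolding I_def using rg xn m' rt k' c
      by (intro exI[of _ "Suc x"] exI[of _ "rt[x := x]"]) (auto simp: regs_ok_def nth_list_update)
    then show "vc w ?body I R' m' (k' - 2)"
      using rg xn m' c big by (simp add: regs_ok_def)
  qed
  obtain c where c: "k = 20 + c" using k le_Suc_ex[of 20 k] by auto
  have w_pos: "w \<noteq> 0" using big by (cases w) auto
  have m: "map Sym T @ replicate (4 * n) (Word 0) =
      layout (replicate n 0) (replicate n 0) (replicate (2 * n) (Word 0))"
    by (simp add: layout_def replicate_add[symmetric])
  have "I ((\<lambda>_. Word 0)(0 := Word n, rOne := Word 1, rMark := Word (2 * n), rOut := Word (3 * n)))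
      (map Sym T @ replicate (4 * n) (Word 0)) (17 + c)"
    unfolding I_def m using c
    by (intro exI[of _ 0] exI[of _ "replicate n 0"]) (simp add: regs_ok_def)
  from loop[OF this] show ?thesis
    unfolding init_code_def Q_def[symmetric] using c big w_pos by (simp add: mult_2[symmetric])
qed

text \<open>Every covered position is charged \<open>K\<close>, so a phrase of length l may use
  \<open>K * l\<close> steps; the lengths add up to n.\<close>

lemma lzrr_code:
  assumes k: "700 * (n + 1) ^ 2 \<le> k"
  shows "vc w lzrr_code (\<lambda>R m k. \<exists>B. outputs \<lparr>pc = 0, regs = R, mem = m\<rparr> B \<and> LZRR_parse T B)
    ((\<lambda>_. Word 0)(0 := Word n)) (map Sym T @ replicate (4 * n) (Word 0)) k"
proof -
  define K where "K = 600 * (n + 1)"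
  have kK: "K * n + 10 * n + 40 \<le> k"
  proof -
    have "K * n + 10 * n + 40 \<le> 700 * (n + 1) ^ 2" by (simp add: K_def power2_eq_square algebra_simps)
    then show ?thesis using k by simp
  qed
  define I where "I R m k' \<longleftrightarrow> (\<exists>P p. parsed P R m \<and> covered P + p = n \<and> K * p + 20 \<le> k')" for R m k'
  define Q where "Q R m k' \<longleftrightarrow> (\<exists>P. parsed P R m \<and> covered P = n) \<and> 1 \<le> k'" for R m and k' :: nat
  have ki: "10 * n + 20 \<le> k" using kK by simp
  show ?thesis
    unfolding lzrr_code_def
  proof (rule vc_seqI[OF init_code[OF ki]], elim conjE)
    fix R1 m1 k1
    assume "parsed [] R1 m1" "k \<le> k1 + 10 * n + 20"
    then have I1: "I R1 m1 k1" unfolding I_def using kK by (intro exI[of _ "[]"] exI[of _ n]) simp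
    have "vc w (Loop (LessC rI rN) (search_code ;; emit_code)) Q R1 m1 k1"
      using I1
    proof (rule vc_loopI[where I = I])
      fix R m k'
      assume "I R m k'"
      then obtain P p where P: "parsed P R m" and p: "covered P + p = n" "K * p + 20 \<le> k'"
        unfolding I_def by blast
      have rg: "R rN = Word n" "R rI = Word (covered P)" using P by (auto simp: parsed_def regs_ok_def)
      show "2 \<le> k' \<and> holds (LessC rI rN) R \<noteq> None" using rg p(2) by simp
      {
        assume "holds (LessC rI rN) R = Some False"
        then show "Q R m (k' - 2)" unfolding Q_def using P p rg by auto
      }
      assume "holds (LessC rI rN) R = Some True"
      then have cov: "covered P < n" using rg by simp
      define L where "L = maxLF T P"
      have L: "covered P + L \<le> n" using covered_maxLF[OF _ cov] P by (simp add: L_def parsed_def)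
      define l where "l = max 1 L"
      have lp: "1 \<le> l" "L \<le> l" "l \<le> p" "L \<le> n" using L cov p(1) by (auto simp: l_def)
      \<comment> \<open>With \<open>1 \<le> l\<close>, \<open>L \<le> l\<close> and
        \<open>L \<le> n\<close>, constant terms are absorbed into multiples of l: 81 + 160 = 241
        and 20 + 50 = 70. The total 552 n l + 82 l is at most \<open>K * l\<close>.\<close>
      have cost: "(81 * L + 160) * (n + L) + n * (20 * L + 50) + 82 \<le> K * l"
      proof -
        have "(81 * L + 160) * (n + L) \<le> (241 * l) * (2 * n)" using lp by (intro mult_mono) auto
        moreover have "n * (20 * L + 50) \<le> n * (70 * l)" using lp by (intro mult_mono) auto
        moreover have "82 \<le> 82 * l" using lp by simp
        moreover have "241 * l * (2 * n) + n * (70 * l) + 82 * l \<le> K * l"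
          by (simp add: K_def algebra_simps)
        ultimately show ?thesis by linarith
      qed
      have "K * l \<le> K * p" using lp by simp
      then have kc: "(81 * L + 160) * (n + L) + n * (20 * L + 50) + 80 \<le> k' - 2"
        using cost p(2) by linarith
      show "vc w (search_code ;; emit_code) I R m (k' - 2)"
      proof (rule vc_mono[OF phrase_code[OF P cov kc[unfolded L_def]]], elim exE conjE)
        fix R2 m2 k2 f
        assume f: "plen f = max 1 (maxLF T P)" "parsed (P @ [f]) R2 m2"
          "k' - 2 \<le> k2 + ((81 * maxLF T P + 160) * (n + maxLF T P) + n * (20 * maxLF T P + 50) + 80)"
        have "K * (p - l) + K * l = K * p" using lp by (simp add: add_mult_distrib2[symmetric])
        then have "K * (p - l) + 20 \<le> k2" using f(3)[folded L_def] cost p(2) by linarith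
        then show "I R2 m2 k2"
          unfolding I_def using f(1,2) p(1) lp
          by (intro exI[of _ "P @ [f]"] exI[of _ "p - l"]) (simp add: l_def L_def)
      qed
    qed
    then show "vc w (Loop (LessC rI rN) (search_code ;; emit_code) ;; Basic (Op Add rN rMark rN))
        (\<lambda>R m k. \<exists>B. outputs \<lparr>pc = 0, regs = R, mem = m\<rparr> B \<and> LZRR_parse T B) R1 m1 k1"
    proof (rule vc_seqI)
      fix R m k'
      assume "Q R m k'"
      then obtain P where P: "parsed P R m" "covered P = n" "1 \<le> k'" unfolding Q_def by blast
      then obtain rt mk out j M js where st: "regs_ok R (length P) n j M js" "length rt = n"
        "m = layout rt mk out" "length mk = n" "take (2 * length P) out = concat (map encode_phrase P)"
        by (auto simp: parsed_def roots_ok_def)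
      have "LZRR_parse T P" using P by (simp add: LZRR_parse_def parsed_def)
      moreover have "drop (3 * n) m = out" using st(2-4) by (simp add: layout_def)
      then have "outputs \<lparr>pc = 0, regs = R(rN := Word (3 * n)), mem = m\<rparr> P"
        unfolding outputs_def using st(1,5) by (intro exI[of _ "3 * n"]) (simp add: regs_ok_def)
      ultimately show "vc w (Basic (Op Add rN rMark rN))
          (\<lambda>R m k. \<exists>B. outputs \<lparr>pc = 0, regs = R, mem = m\<rparr> B \<and> LZRR_parse T B) R m k'"
        using st(1) P(3) big by (auto simp: regs_ok_def)
    qed
  qed
qed

end

section \<open>Asymptotic bounds and word size\<close>

lemma less_ackermann: "0 < j \<Longrightarrow> j < ackermann k j"
proof (induction k j rule: ackermann.induct)
  case (3 k j)
  have "Suc j \<le> ackermann (Suc k) j" using 3(1) by (cases "j = 0") auto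
  then show ?case using 3(2) by simp
qed auto

text \<open>Every positive row takes the value 1 at 0, so 0 cannot be the inverse of a number above
  1; \<open>less_ackermann\<close> guarantees that the least element exists.\<close>

lemma ack_row_inverse_pos:
  assumes "2 \<le> x" "0 < k"
  shows "0 < ack_row_inverse k x"
proof -
  have "x \<le> ackermann k (ack_row_inverse k x)"
    unfolding ack_row_inverse_def by (rule LeastI[of _ x]) (use assms less_ackermann[of x k] in simp)
  moreover have "ackermann k 0 = 1" using assms(2) by (cases k) auto
  ultimately show ?thesis using assms(1) by (cases "ack_row_inverse k x") auto
qed

text \<open>For n = 0 and n = 1 the inverse factor is 0, so the estimate holds only from n = 2 on.
  The constant is 700 times 4, the latter from \<open>n + 1 \<le> 2 * n\<close>.\<close>

lemma quadratic_bigo_ack: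
  "(\<lambda>n. real (700 * (n + 1) ^ 2)) \<in> O(\<lambda>n. real n ^ 2 * real (ack_row_inverse (n ^ 2) (n ^ 2)))"
proof (rule bigoI[where c = 2800])
  show "\<forall>\<^sub>F n in sequentially. norm (real (700 * (n + 1) ^ 2)) \<le>
      2800 * norm (real n ^ 2 * real (ack_row_inverse (n ^ 2) (n ^ 2)))"
  proof (rule eventually_sequentiallyI[of 2])
    fix n :: nat
    assume n: "2 \<le> n"
    have "2 \<le> n ^ 2" using n power_mono[of 2 n 2] by simp
    then have "1 \<le> real (ack_row_inverse (n ^ 2) (n ^ 2))"
      using ack_row_inverse_pos[of "n ^ 2" "n ^ 2"] n by simp
    then have "real n ^ 2 * 1 \<le> real n ^ 2 * real (ack_row_inverse (n ^ 2) (n ^ 2))"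
      by (intro mult_left_mono) auto
    moreover have "(1 + real n) ^ 2 \<le> (2 * real n) ^ 2" using n by (intro power_mono) auto
    ultimately show "norm (real (700 * (n + 1) ^ 2)) \<le>
        2800 * norm (real n ^ 2 * real (ack_row_inverse (n ^ 2) (n ^ 2)))"
      by (simp add: power_mult_distrib)
  qed
qed

text \<open>Of the four factors \<open>n + 2\<close> one is kept; the other three are at least 2
  each and give 8, which exceeds the required 6.\<close>

lemma word_size_bound:
  assumes "real w \<ge> 4 * log 2 (real n + 2)"
  shows "6 * n + 6 < (2::nat) ^ w"
proof -
  have "(real n + 2) ^ 4 = (real n + 2) powr 4" by (simp add: powr_numeral)
  also have "\<dots> = 2 powr (4 * log 2 (real n + 2))"
    by (simp add: powr_powr[symmetric] mult.commute[of 4])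
  also have "\<dots> \<le> 2 powr real w" using assms by simp
  also have "\<dots> = real (2 ^ w)" by (simp add: powr_realpow)
  finally have "real ((n + 2) ^ 4) \<le> real (2 ^ w)" by (simp add: add.commute)
  then have le: "(n + 2) ^ 4 \<le> (2::nat) ^ w" by (simp only: of_nat_le_iff)
  have "6 * n + 6 < 2 ^ 3 * (n + 2)" by simp
  also have "\<dots> \<le> (n + 2) ^ 3 * (n + 2)" by (intro mult_mono power_mono) auto
  also have "\<dots> = (n + 2) ^ 4" by (simp only: power_Suc2[symmetric]) (simp add: numeral_eq_Suc)
  also note le
  finally show ?thesis .
qed

theorem theorem1:
  shows "\<exists>(prog :: instr list) (\<kappa> :: real) (time :: nat \<Rightarrow> nat) (space :: nat \<Rightarrow> nat).
    \<kappa> \<ge> 1 \<and>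
    (\<lambda>n. real (time n)) \<in> O(\<lambda>n. real n ^ 2 * real (ack_row_inverse (n ^ 2) (n ^ 2))) \<and>
    (\<lambda>n. real (space n)) \<in> O(\<lambda>n. real n) \<and>
    (\<forall>(T :: 'a::linorder list) (w :: nat).
       real w \<ge> \<kappa> * log 2 (real (length T) + 2) \<longrightarrow>
       computes_LZRR prog w (time (length T)) (space (length T)) T)"
proof (rule exI[of _ "compile 0 lzrr_code @ [Halt]"], rule exI[of _ 4],
    rule exI[of _ "\<lambda>n. 700 * (n + 1) ^ 2"], rule exI[of _ "\<lambda>n. 4 * n"], intro conjI allI impI)
  \<comment> \<open>Four extra words per position: a root, a stamp, and two output cells for at most
    one phrase.\<close>
  show "(\<lambda>n. real (4 * n)) \<in> O(\<lambda>n. real n)" by simp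
next
  fix T :: "'a list" and w :: nat
  assume "4 * log 2 (real (length T) + 2) \<le> real w"
  then interpret word_ram_input T w by unfold_locales (rule word_size_bound)
  show "computes_LZRR (compile 0 lzrr_code @ [Halt]) w (700 * (length T + 1) ^ 2) (4 * length T) T"
    by (rule computes_LZRRI, rule lzrr_code) simp
qed (simp, rule quadratic_bigo_ack)

end
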